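(* Fix an ambient dimension $d\ge 1$ and $0<\alpha\le 1/2$. There exists a continuous real-valued function $t_{d,\alpha}(\varepsilon)$ of $\varepsilon\in[0,1)$ with the following properties: (i) $t_{d,\alpha}(\varepsilon)>0$ whenever $\varepsilon<2^{-2d}d^{-d/2}\alpha^d$. (ii) If $\varepsilon$ is small enough (depending on $d,\alpha$), then $t_{d,\alpha}(\varepsilon)>c_d\cdot\alpha^d$, where \[ c_d=\frac{2}{5\,\log 2\cdot 2^{4d}\cdot d^{d/2}}. \] In particular, this holds for $\varepsilon=0$. (iii) If a Borel probability measure $\mu$ on $\mathbb{R}^d$ is mean $(\alpha,\eta,\varepsilon)$-porous, where $0<\eta\le1$ and $0\le\varepsilon<1$, then \[ \dim_P(\mu)\le d-\eta\cdot t_{d,\alpha}(\varepsilon). \]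
   Context: $\log$ is the natural logarithm, $B(x,r)$ is the closed Euclidean ball of centre $x$ and radius $r$, and $[n]=\{0,\ldots,n-1\}$. For a Borel probability measure $\mu$ on $\mathbb{R}^d$, $x\in\operatorname{supp}\mu$, $r>0$ and $\varepsilon\ge 0$, define \[ \operatorname{por}(\mu,x,r,\varepsilon)=\sup\left\{\alpha\ge 0:\ \inf_{B(y,\alpha r)\subset B(x,r)}\frac{\mu(B(y,\alpha r))}{\mu(B(x,r))}\le\varepsilon\right\}, \] where the infimum is over all $y$ with $B(y,\alpha r)\subset B(x,r)$. For $0<\alpha\le 1/2$, $0<\eta\le 1$ and $0\le\varepsilon<1$, $\mu$ is mean $(\alpha,\eta,\varepsilon)$-porous if \[ \liminf_{n\to\infty}\frac1n\left|\{i\in[n]:\operatorname{por}(\mu,x,2^{-i},\varepsilon)\ge\alpha\}\right|\ge\eta \] for $\mu$-almost every $x$. The (upper) packing dimension $\dim_P(\mu)$ is the $\mu$-essential supremum over $x$ of the upper local dimension $\limsup_{r\to0}\frac{\log\mu(B(x,r))}{\log r}$. *)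

theory Defs
  imports "HOL-Analysis.Analysis" "HOL-Probability.Probability"
begin

text \<open>
  The infimum is taken in the extended reals, so that it is \<open>\<infinity>\<close> when no ball of radius
  \<open>a * r\<close> fits into \<open>cball x r\<close>; such \<open>a\<close> therefore do not contribute to the supremum.
\<close>
definition por :: "'a::metric_space measure \<Rightarrow> 'a \<Rightarrow> real \<Rightarrow> real \<Rightarrow> ereal" where
  "por \<mu> x r \<epsilon> =
     (SUP a \<in> {a::real. 0 \<le> a \<and>
         (INF y \<in> {y. cball y (a * r) \<subseteq> cball x r}.
            ereal (measure \<mu> (cball y (a * r)) / measure \<mu> (cball x r))) \<le> ereal \<epsilon>}.
      ereal a)"

definition mean_porous :: "'a::metric_space measure \<Rightarrow> real \<Rightarrow> real \<Rightarrow> real \<Rightarrow> bool" where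
  "mean_porous \<mu> \<alpha> \<eta> \<epsilon> \<longleftrightarrow>
     (AE x in \<mu>.
        liminf (\<lambda>n. ereal (1 / real n *
                 real (card {i \<in> {0..<n}. por \<mu> x (2 powr (- real i)) \<epsilon> \<ge> ereal \<alpha>})))
          \<ge> ereal \<eta>)"

text \<open>
  Outside the support of \<open>\<mu>\<close>, which for a Borel probability measure on a Euclidean space is a
  null set, the value below is an artefact of \<open>ln 0 = 0\<close>; it has no influence on the essential
  supremum.
\<close>
definition upper_local_dim :: "'a::metric_space measure \<Rightarrow> 'a \<Rightarrow> ereal" where
  "upper_local_dim \<mu> x =
     Limsup (at_right 0) (\<lambda>r. ereal (ln (measure \<mu> (cball x r)) / ln r))"

text \<open>
  \<open>esssup\<close> is \<open>\<infinity>\<close> by convention on non-measurable functions; this case does not arise here, as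
  \<open>upper_local_dim \<mu>\<close> is Borel measurable for a Borel probability measure on a Euclidean space.
\<close>
definition packing_dim :: "'a::metric_space measure \<Rightarrow> ereal" where
  "packing_dim \<mu> = esssup \<mu> (upper_local_dim \<mu>)"

definition c_const :: "nat \<Rightarrow> real" where
  "c_const d = 2 / (5 * ln 2 * 2 ^ (4 * d) * real d powr (real d / 2))"

end

theory Submission
  imports Defs "HOL-Number_Theory.Cong" "HOL-Real_Asymp.Real_Asymp"
begin

text \<open>
  The packing dimension is small if, for almost every \<open>x\<close>, all small balls around \<open>x\<close> carry much
  more mass than \<open>r ^ d\<close>. Such a lower bound for the mass comes from a comparison of \<open>\<mu>\<close> with the
  volume along a dyadic grid. If \<open>x\<close> lies well inside its grid cell \<open>Q\<close> at a porous scale, then \<open>Q\<close>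
  has a descendant \<open>R\<close>, a fixed number \<open>k\<close> of levels below, of relative volume \<open>q = 2 powr (- d * k)\<close>
  and of relative mass at most \<open>\<epsilon> < q\<close>. As \<open>\<mu>\<close> hardly charges \<open>R\<close>, the rest of \<open>Q\<close> has more mass
  than its share of the volume, and each such hole gains a constant factor \<open>g > 1\<close>. In precise terms,
  if \<open>N Q\<close> counts the holes that the ancestors of a cell \<open>Q\<close> have, then the sum of
  \<open>sqrt (g ^ N Q * \<mu> Q * vol Q)\<close> over the cells \<open>Q\<close> of one level stays bounded
  (\<open>sum_descendants_le\<close>). By Borel--Cantelli the cell \<open>Q\<close> of level \<open>n\<close> around almost every \<open>x\<close> then
  satisfies \<open>\<mu> Q \<ge> g ^ N Q * vol Q\<close> up to a factor polynomial in \<open>n\<close> (\<open>AE_cell_mass_ge\<close>).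

  Two difficulties have to be overcome. The first is that holes of different scales overlap: one
  large hole can serve \<open>k\<close> consecutive scales. To treat the scales modulo \<open>k\<close> separately would cost a
  factor \<open>k\<close>, of order \<open>log (1 / \<alpha>)\<close>, which the claimed bound \<open>c * \<alpha> ^ d\<close> does not allow. Instead, at
  most one hole is pending at a time, and it stays pending until the branch has left the line of
  ancestors of the hole or has reached the hole itself; meanwhile every further hole is paid for by
  the pending one. Since each step towards the hole has only the share \<open>2 powr (- d)\<close> of the volume,
  the number of scales that one hole has to pay for is at most \<open>1 / (1 - 2 powr (- d)) \<le> 2\<close> on
  average. The potential that makes this precise does not increase from a cell to its children taken
  together (\<open>potential_children\<close>).

  The second difficulty is that \<open>x\<close> may be close to the boundary of its cell. The grid is therefore
  shifted, in each coordinate, by the multiples of \<open>L / M\<close>, where \<open>L\<close> is the side length at level \<open>0\<close>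
  and \<open>M\<close> is odd. Multiplication by \<open>2 ^ i\<close> permutes the residues modulo \<open>M\<close>, hence at every scale
  and for every \<open>x\<close> at least a fixed proportion \<open>p\<close> of the finitely many shifts puts \<open>x\<close> well inside
  its cell. So for every \<open>n\<close> some shift does this for at least a proportion \<open>p\<close> of the porous scales
  below \<open>n\<close> (\<open>exists_good_shift\<close>).

  Altogether \<open>packing_dim \<mu> \<le> d - \<eta> * p * log 2 g\<close> with
  \<open>g = 1 + (1 - 2 powr (- d)) * (sqrt q - sqrt \<epsilon>)\<^sup>2\<close> (\<open>packing_dim_le\<close>). The function \<open>t\<close> is the
  maximum of two such expressions. For the first one \<open>q\<close> is as large as possible, so that \<open>t\<close> is
  positive up to the required threshold, at the price of a small \<open>p\<close>; for the second one the product \<open>p * q\<close>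
  is large, so that \<open>t 0\<close> is of the required size.
\<close>

section \<open>Comparison of mass and volume on a tree with holes\<close>

lemma sum_sqrt_le:
  fixes f g :: "'b \<Rightarrow> real"
  assumes "\<And>x. x \<in> A \<Longrightarrow> 0 \<le> f x" "\<And>x. x \<in> A \<Longrightarrow> 0 \<le> g x"
  shows "(\<Sum>x\<in>A. sqrt (f x * g x)) \<le> sqrt (sum f A * sum g A)"
proof -
  have "(\<Sum>x\<in>A. sqrt (f x) * sqrt (g x))\<^sup>2 \<le> (\<Sum>x\<in>A. (sqrt (f x))\<^sup>2) * (\<Sum>x\<in>A. (sqrt (g x))\<^sup>2)"
    by (rule Cauchy_Schwarz_ineq_sum)
  also have "\<dots> = sum f A * sum g A" using assms by (simp cong: sum.cong)
  finally show ?thesis unfolding real_sqrt_mult[of "f _"] by (rule real_le_rsqrt)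
qed

text \<open>
  The nodes of level \<open>n\<close> are the elements of \<open>'i\<close>, the same for all \<open>n\<close>; \<open>m n\<close> is the mass of the
  nodes of level \<open>n\<close>. A hole of a node is a descendant \<open>k\<close> levels below with at most the share \<open>\<epsilon>\<close> of
  its mass, where \<open>\<epsilon>\<close> is bounded by the share of the volume.
\<close>
locale holed_tree =
  fixes par :: "'i \<Rightarrow> 'i" and B k :: nat and m :: "nat \<Rightarrow> 'i \<Rightarrow> real"
    and \<epsilon> :: real and hole :: "nat \<Rightarrow> 'i \<Rightarrow> 'i option"
  assumes B_pos: "0 < B"
    and card_children: "card (par -` {z}) = B"
    and m_nonneg: "0 \<le> m n z"
    and m_children: "m n z = (\<Sum>y\<in>par -` {z}. m (Suc n) y)"
    and k_pos: "0 < k"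
    and hole_below: "hole n z = Some R \<Longrightarrow> (par ^^ k) R = z"
    and hole_mass: "hole n z = Some R \<Longrightarrow> m (n + k) R \<le> \<epsilon> * m n z"
    and eps: "0 < \<epsilon>" "\<epsilon> \<le> (1 / real B) ^ k"
begin

definition "child_vol = 1 / real B"
definition "hole_vol = child_vol ^ k"
text \<open>
  The mass in a pending hole is overweighted by the factor \<open>1 / \<kappa>\<close> and its volume underweighted by
  the factor \<open>\<kappa>\<close>, so that both effects cancel once the hole is reached. A hole can pay for
  \<open>(1 - \<kappa>) * (hole_vol - \<epsilon> / \<kappa>)\<close>, and the present \<open>\<kappa>\<close> maximises this quantity, with value \<open>slack\<close>.
\<close>
definition "\<kappa> = sqrt (\<epsilon> / hole_vol)"
definition "slack = (sqrt hole_vol - sqrt \<epsilon>)\<^sup>2"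
definition "gain = 1 + (1 - child_vol) * slack"

text \<open>
  The relative volume that may be discounted from a node whose pending hole is \<open>j\<close> levels below: the
  discount on the volume of the hole minus the cost of the \<open>j\<close> scales on the way to it. It solves the
  recursion \<open>deficit_Suc\<close> with initial value \<open>1 - \<kappa>\<close>.
\<close>
definition deficit :: "nat \<Rightarrow> real" where "deficit j = (1 - \<kappa>) * child_vol ^ j - slack * (1 - child_vol ^ j)"

definition claim :: "nat \<Rightarrow> 'i \<Rightarrow> (nat \<times> 'i) option" where
  "claim n z = map_option (\<lambda>R. (k, R)) (hole n z)"

text \<open>
  The hole on which the branch ending in \<open>z\<close> currently waits, together with the number of levels
  between \<open>z\<close> and that hole. A hole of \<open>z\<close> is ignored as long as another hole is pending below \<open>z\<close>.
\<close>
fun pending :: "nat \<Rightarrow> 'i \<Rightarrow> (nat \<times> 'i) option" where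
  "pending 0 z = claim 0 z"
| "pending (Suc n) z = (case pending n (par z) of
      Some (j, R) \<Rightarrow> if 1 < j \<and> (par ^^ (j - 1)) R = z then Some (j - 1, R) else claim (Suc n) z
    | None \<Rightarrow> claim (Suc n) z)"

fun hole_count :: "nat \<Rightarrow> 'i \<Rightarrow> nat" where
  "hole_count 0 z = 0"
| "hole_count (Suc n) z = hole_count n (par z) + (if hole n (par z) = None then 0 else 1)"

definition tilted_mass :: "nat \<Rightarrow> 'i \<Rightarrow> (nat \<times> 'i) option \<Rightarrow> real" where
  "tilted_mass n z s = m n z + (case s of None \<Rightarrow> 0 | Some (j, R) \<Rightarrow> (1 / \<kappa> - 1) * m (n + j) R)"

definition tilted_vol :: "nat \<Rightarrow> (nat \<times> 'i) option \<Rightarrow> real" where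
  "tilted_vol n s = child_vol ^ n * (1 - (case s of None \<Rightarrow> 0 | Some (j, R) \<Rightarrow> deficit j))"

text \<open>
  A Hellinger-type affinity between mass and volume, both modified according to the pending hole and
  multiplied by the gains collected so far.
\<close>
definition potential :: "nat \<Rightarrow> 'i \<Rightarrow> real" where
  "potential n z = sqrt (gain ^ hole_count n z * (tilted_mass n z (pending n z) * tilted_vol n (pending n z)))"

lemma finite_children [simp]: "finite (par -` {z})"
  using card_children[of z] B_pos card_ge_0_finite by auto

lemma child_vol_bounds: "0 < child_vol" "child_vol \<le> 1"
  using B_pos by (auto simp: child_vol_def)

lemma hole_vol_bounds: "0 < hole_vol" "hole_vol \<le> 1" "\<epsilon> \<le> hole_vol"
  using child_vol_bounds eps by (auto simp: hole_vol_def child_vol_def power_le_one)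

lemma kappa_bounds: "0 < \<kappa>" "\<kappa> \<le> 1"
  using hole_vol_bounds eps by (auto simp: \<kappa>_def)

lemma kappa_inverse: "0 \<le> 1 / \<kappa> - 1"
  using kappa_bounds by (auto simp: field_simps)

lemma gain_ge_1: "1 \<le> gain"
  using child_vol_bounds by (auto simp: gain_def slack_def)

lemma slack_nonneg: "0 \<le> slack" by (simp add: slack_def)

lemma deficit_0: "deficit 0 = 1 - \<kappa>" by (simp add: deficit_def)

lemma deficit_Suc: "deficit (Suc j) = child_vol * deficit j - (1 - child_vol) * slack"
  by (simp add: deficit_def algebra_simps)

lemma deficit_le: "deficit j \<le> 1 - \<kappa>"
proof -
  have "child_vol ^ j \<le> 1" using child_vol_bounds by (simp add: power_le_one)
  hence "(1 - \<kappa>) * child_vol ^ j \<le> (1 - \<kappa>) * 1" "0 \<le> slack * (1 - child_vol ^ j)"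
    using kappa_bounds slack_nonneg by (auto simp del: mult_1_right intro: mult_left_mono)
  thus ?thesis by (simp add: deficit_def)
qed

text \<open>
  This is where \<open>\<kappa>\<close> and \<open>slack\<close> are tuned: \<open>deficit k\<close> outweighs the overweighting of the mass of a
  new hole.
\<close>
lemma deficit_k: "\<epsilon> * (1 / \<kappa> - 1) \<le> deficit k"
proof -
  define s where "s = sqrt hole_vol"
  define e where "e = sqrt \<epsilon>"
  have s: "s > 0" "hole_vol = s\<^sup>2" and e: "e > 0" "\<epsilon> = e\<^sup>2" using hole_vol_bounds eps by (auto simp: s_def e_def)
  have kap: "\<kappa> = e / s" by (simp add: \<kappa>_def s_def e_def real_sqrt_divide)
  have "\<epsilon> * (1 / \<kappa> - 1) = (1 - \<kappa>) * hole_vol - slack"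
    unfolding slack_def kap s_def[symmetric] e_def[symmetric] using s(1) e(1)
    unfolding s(2) e(2) by (simp add: field_simps power2_eq_square)
  also have "\<dots> \<le> (1 - \<kappa>) * hole_vol - slack * (1 - hole_vol)"
    using hole_vol_bounds slack_nonneg by (simp add: mult_left_le)
  finally show ?thesis by (simp add: deficit_def hole_vol_def)
qed

text \<open>
  Downward induction from \<open>j = k\<close>, because \<open>deficit (Suc j)\<close> is smaller than a multiple of \<open>deficit j\<close>.
\<close>
lemma deficit_nonneg: "j \<le> k \<Longrightarrow> 0 \<le> deficit j"
proof (induction "k - j" arbitrary: j)
  case 0
  hence "j = k" by simp
  moreover have "0 \<le> \<epsilon> * (1 / \<kappa> - 1)" using eps kappa_inverse by simp
  ultimately show ?case using deficit_k by simp
next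
  case (Suc x)
  hence "0 \<le> deficit (Suc j)" by simp
  moreover have "0 \<le> (1 - child_vol) * slack" using child_vol_bounds slack_nonneg by simp
  ultimately have "0 \<le> child_vol * deficit j" using deficit_Suc[of j] by linarith
  thus ?case using child_vol_bounds by (simp add: zero_le_mult_iff)
qed

text \<open>
  The right side is the relative modified volume of a node that waits for a hole \<open>j\<close> levels below, and
  \<open>1 - child_vol * deficit (j - 1)\<close> is that of its children together. The loss pays for one more gain.
\<close>
lemma gain_step:
  assumes "0 < j" "j \<le> k"
  shows "gain * (1 - child_vol * deficit (j - 1)) \<le> 1 - deficit j"
proof -
  obtain i where j: "j = Suc i" using assms by (cases j) auto
  have "0 \<le> (1 - child_vol) * slack * (child_vol * deficit i)"
    using child_vol_bounds slack_nonneg deficit_nonneg[of i] assms j by simp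
  thus ?thesis by (simp add: gain_def deficit_Suc j algebra_simps)
qed

text \<open>
  A new hole does not increase the potential: its overweighted mass is small by assumption, and with
  \<open>e = \<epsilon> * (1 / \<kappa> - 1)\<close> the two modifications are at most \<open>1 + e\<close> and \<open>1 - e\<close>.
\<close>
lemma claim_le: "tilted_mass n z (claim n z) * tilted_vol n (claim n z) \<le> m n z * child_vol ^ n"
proof (cases "hole n z")
  case None
  thus ?thesis by (simp add: claim_def tilted_mass_def tilted_vol_def)
next
  case (Some R)
  let ?e = "\<epsilon> * (1 / \<kappa> - 1)"
  note k0 = kappa_inverse
  have "(1 / \<kappa> - 1) * m (n + k) R \<le> (1 / \<kappa> - 1) * (\<epsilon> * m n z)"
    using hole_mass[OF Some] k0 by (rule mult_left_mono)
  hence t: "tilted_mass n z (claim n z) \<le> m n z * (1 + ?e)"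
    using Some by (simp add: claim_def tilted_mass_def algebra_simps)
  have u: "tilted_vol n (claim n z) \<le> child_vol ^ n * (1 - ?e)"
    using Some deficit_k child_vol_bounds by (simp add: claim_def tilted_vol_def mult_left_mono)
  have u0: "0 \<le> tilted_vol n (claim n z)"
    using Some deficit_le[of k] kappa_bounds child_vol_bounds by (simp add: claim_def tilted_vol_def)
  have "tilted_mass n z (claim n z) * tilted_vol n (claim n z) \<le> (m n z * (1 + ?e)) * (child_vol ^ n * (1 - ?e))"
    using t u u0 m_nonneg eps k0 by (intro mult_mono) auto
  also have "\<dots> = m n z * child_vol ^ n * (1 - ?e\<^sup>2)" by (simp add: algebra_simps power2_eq_square)
  also have "\<dots> \<le> m n z * child_vol ^ n * 1"
    using m_nonneg child_vol_bounds by (intro mult_left_mono) auto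
  finally show ?thesis by simp
qed

lemma pending_cases:
  assumes "pending n z = Some (j, R)"
  shows "0 < j \<and> j \<le> k \<and> (par ^^ j) R = z"
  using assms
proof (induction n arbitrary: z j R)
  case 0
  thus ?case using k_pos hole_below by (auto simp: claim_def)
next
  case (Suc n)
  show ?case
  proof (cases "\<exists>i R'. pending n (par z) = Some (i, R') \<and> 1 < i \<and> (par ^^ (i - 1)) R' = z")
    case True
    then obtain i R' where i: "pending n (par z) = Some (i, R')" "1 < i" "(par ^^ (i - 1)) R' = z"
      by blast
    hence "j = i - 1" "R = R'" using Suc.prems by simp_all
    with Suc.IH[OF i(1)] i show ?thesis by auto
  next
    case False
    hence "pending (Suc n) z = claim (Suc n) z"
      by (cases "pending n (par z)") (auto simp del: funpow.simps)
    thus ?thesis using Suc.prems k_pos hole_below by (auto simp: claim_def)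
  qed
qed

lemma pending_None_hole: "pending n z = None \<Longrightarrow> hole n z = None"
  by (cases n) (auto simp: claim_def split: option.splits if_splits)

lemma tilted_mass_ge: "m n z \<le> tilted_mass n z s"
  using m_nonneg kappa_inverse by (auto simp: tilted_mass_def split: option.splits intro: mult_nonneg_nonneg)

lemma tilted_vol_ge: "child_vol ^ n * \<kappa> \<le> tilted_vol n s"
proof -
  have "(case s of None \<Rightarrow> 0 | Some (j, R) \<Rightarrow> deficit j) \<le> 1 - \<kappa>"
    using deficit_le kappa_bounds by (auto split: option.splits)
  thus ?thesis using child_vol_bounds unfolding tilted_vol_def by (intro mult_left_mono) auto
qed

lemma potential_ge: "sqrt (gain ^ hole_count n z * (m n z * (child_vol ^ n * \<kappa>))) \<le> potential n z"
  unfolding potential_def using gain_ge_1 tilted_mass_ge tilted_vol_ge m_nonneg child_vol_bounds kappa_bounds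
  by (intro real_sqrt_le_mono mult_left_mono mult_mono)
     (auto intro: order_trans[OF m_nonneg] intro!: mult_nonneg_nonneg)

text \<open>
  The key step. The modified masses of the children add up to at most that of the parent. If the parent
  has a hole, then some hole is pending, so that the modified volumes of the children fall short of that
  of the parent by the factor \<open>gain\<close>, according to \<open>gain_step\<close>; this compensates the increase of
  \<open>hole_count\<close>. The Cauchy--Schwarz inequality combines masses and volumes.
\<close>
lemma potential_children: "(\<Sum>y\<in>par -` {z}. potential (Suc n) y) \<le> potential n z"
proof -
  let ?C = "par -` {z}"
  define G where "G = gain ^ hole_count n z"
  have G0: "0 \<le> G" using gain_ge_1 by (simp add: G_def)
  show ?thesis
  proof (cases "pending n z")
    case None
    hence h: "hole n z = None" by (rule pending_None_hole)
    have "(\<Sum>y\<in>?C. potential (Suc n) y) \<le> (\<Sum>y\<in>?C. sqrt (G * m (Suc n) y * child_vol ^ Suc n))"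
    proof (rule sum_mono)
      fix y assume y: "y \<in> ?C"
      hence "pending (Suc n) y = claim (Suc n) y" "hole_count (Suc n) y = hole_count n z" using None h by auto
      thus "potential (Suc n) y \<le> sqrt (G * m (Suc n) y * child_vol ^ Suc n)"
        using claim_le[of "Suc n" y] G0 unfolding potential_def G_def
        by (simp add: mult_left_mono mult.assoc del: power_Suc)
    qed
    also have "\<dots> \<le> sqrt ((\<Sum>y\<in>?C. G * m (Suc n) y) * (\<Sum>y\<in>?C. child_vol ^ Suc n))"
      using G0 m_nonneg child_vol_bounds by (intro sum_sqrt_le) auto
    also have "\<dots> = sqrt (G * m n z * child_vol ^ n)"
      using B_pos by (simp add: sum_distrib_left[symmetric] m_children[symmetric] card_children child_vol_def)
    also have "\<dots> = potential n z" using None by (simp add: potential_def G_def tilted_mass_def tilted_vol_def mult.assoc)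
    finally show ?thesis .
  next
    case (Some s)
    then obtain j R where p: "pending n z = Some (j, R)" by (cases s) auto
    have j: "0 < j" "j \<le> k" "(par ^^ j) R = z" using pending_cases[OF p] by auto
    define c where "c = (par ^^ (j - 1)) R"
    have c: "c \<in> ?C" using j unfolding c_def by (cases j) auto
    \<comment> \<open>\<open>c\<close> is the child that is, or contains, the pending hole; \<open>X\<close> and \<open>Y\<close> are the modified mass and volume of
      the children before they may claim holes of their own.\<close>
    define G' where "G' = (if hole n z = None then 1 else gain) * G"
    have G'0: "0 \<le> G'" using G0 gain_ge_1 by (simp add: G'_def)
    define X where "X y = m (Suc n) y + (if y = c then (1 / \<kappa> - 1) * m (n + j) R else 0)" for y
    define Y where "Y y = child_vol ^ Suc n * (1 - (if y = c then deficit (j - 1) else 0))" for y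
    note k0 = kappa_inverse
    have X0: "0 \<le> X y" for y using m_nonneg k0 by (simp add: X_def)
    have Y0: "0 \<le> Y y" for y using deficit_le[of "j - 1"] kappa_bounds child_vol_bounds by (simp add: Y_def)
    have XY: "tilted_mass (Suc n) y (pending (Suc n) y) * tilted_vol (Suc n) (pending (Suc n) y) \<le> X y * Y y"
      if y: "y \<in> ?C" for y
    proof (cases "1 < j \<and> y = c")
      case True
      hence "pending (Suc n) y = Some (j - 1, R)" using y p by (simp add: c_def)
      thus ?thesis using True by (simp add: tilted_mass_def tilted_vol_def X_def Y_def)
    next
      case False
      hence "pending (Suc n) y = claim (Suc n) y" using y p by (auto simp: c_def)
      hence "tilted_mass (Suc n) y (pending (Suc n) y) * tilted_vol (Suc n) (pending (Suc n) y) \<le> m (Suc n) y * child_vol ^ Suc n"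
        using claim_le[of "Suc n" y] by simp
      also have "\<dots> \<le> X y * Y y"
      proof (cases "y = c")
        case True
        \<comment> \<open>The hole itself is reached: the two tilts \<open>1 / \<kappa>\<close> and \<open>\<kappa>\<close> cancel.\<close>
        with False j have j1: "j = 1" by auto
        hence "R = y" using True by (simp add: c_def)
        thus ?thesis using True j1 kappa_bounds by (simp add: X_def Y_def deficit_0 field_simps)
      qed (simp add: X_def Y_def)
      finally show ?thesis .
    qed
    have "(\<Sum>y\<in>?C. potential (Suc n) y) \<le> (\<Sum>y\<in>?C. sqrt (G' * X y * Y y))"
    proof (rule sum_mono)
      fix y assume y: "y \<in> ?C"
      hence "gain ^ hole_count (Suc n) y = G'" by (auto simp: G_def G'_def)
      thus "potential (Suc n) y \<le> sqrt (G' * X y * Y y)"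
        using XY[OF y] G'0 unfolding potential_def by (simp add: mult_left_mono mult.assoc)
    qed
    also have "\<dots> \<le> sqrt ((\<Sum>y\<in>?C. G' * X y) * (\<Sum>y\<in>?C. Y y))"
      using G'0 X0 Y0 by (intro sum_sqrt_le) auto
    also have "(\<Sum>y\<in>?C. G' * X y) = G' * tilted_mass n z (pending n z)"
      using c unfolding X_def sum_distrib_left[symmetric]
      by (simp add: sum.distrib m_children[symmetric] tilted_mass_def p)
    also have "(\<Sum>y\<in>?C. Y y) = child_vol ^ n * (1 - child_vol * deficit (j - 1))"
    proof -
      have "(\<Sum>y\<in>?C. Y y) = child_vol ^ Suc n * (real B - deficit (j - 1))"
        using c unfolding Y_def sum_distrib_left[symmetric] by (simp add: sum_subtractf card_children)
      also have "\<dots> = child_vol ^ n * (1 - child_vol * deficit (j - 1))"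
        using B_pos by (simp add: child_vol_def field_simps)
      finally show ?thesis .
    qed
    also have "sqrt (G' * tilted_mass n z (pending n z) * (child_vol ^ n * (1 - child_vol * deficit (j - 1)))) \<le> potential n z"
      unfolding potential_def G_def[symmetric]
    proof (rule real_sqrt_le_mono)
      have "child_vol * deficit (j - 1) \<le> 1 * deficit (j - 1)"
        using child_vol_bounds deficit_nonneg[of "j - 1"] j by (intro mult_right_mono) auto
      hence "0 \<le> 1 - child_vol * deficit (j - 1)" using deficit_le[of "j - 1"] kappa_bounds by linarith
      hence "(if hole n z = None then 1 else gain) * (1 - child_vol * deficit (j - 1)) \<le> gain * (1 - child_vol * deficit (j - 1))"
        using gain_ge_1 by (intro mult_right_mono) auto
      also have "\<dots> \<le> 1 - deficit j" using gain_step j by simp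
      finally have "(G * tilted_mass n z (pending n z) * child_vol ^ n) * ((if hole n z = None then 1 else gain) * (1 - child_vol * deficit (j - 1)))
        \<le> (G * tilted_mass n z (pending n z) * child_vol ^ n) * (1 - deficit j)"
        using G0 child_vol_bounds order_trans[OF m_nonneg tilted_mass_ge] by (intro mult_left_mono) auto
      thus "G' * tilted_mass n z (pending n z) * (child_vol ^ n * (1 - child_vol * deficit (j - 1)))
          \<le> G * (tilted_mass n z (pending n z) * tilted_vol n (pending n z))"
        unfolding G'_def by (simp add: tilted_vol_def p mult_ac)
    qed
    finally show ?thesis .
  qed
qed

fun descendants :: "nat \<Rightarrow> 'i \<Rightarrow> 'i set" where
  "descendants 0 z = {z}"
| "descendants (Suc n) z = par -` descendants n z"

lemma finite_descendants: "finite (descendants n z)"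
proof (induction n)
  case (Suc n)
  have "descendants (Suc n) z = (\<Union>y\<in>descendants n z. par -` {y})" by auto
  thus ?case using Suc by simp
qed simp

lemma sum_potential_le: "(\<Sum>y\<in>descendants n z. potential n y) \<le> sqrt (m 0 z)"
proof (induction n)
  case 0
  show ?case using claim_le[of 0 z] by (simp add: potential_def)
next
  case (Suc n)
  have "descendants (Suc n) z = (\<Union>y\<in>descendants n z. par -` {y})" by auto
  hence "(\<Sum>y\<in>descendants (Suc n) z. potential (Suc n) y) = (\<Sum>x\<in>descendants n z. \<Sum>y\<in>par -` {x}. potential (Suc n) y)"
    by (auto simp: finite_descendants intro!: sum.UNION_disjoint)
  also have "\<dots> \<le> (\<Sum>x\<in>descendants n z. potential n x)" by (intro sum_mono potential_children)
  finally show ?case using Suc by simp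
qed

lemma sum_descendants_le:
  "(\<Sum>y\<in>descendants n z. sqrt (gain ^ hole_count n y * (m n y * (child_vol ^ n * \<kappa>)))) \<le> sqrt (m 0 z)"
  by (rule order_trans[OF sum_mono[OF potential_ge] sum_potential_le])

end

section \<open>Almost every branch carries a large mass\<close>

context holed_tree begin

lemma descendants_iff: "y \<in> descendants n z \<longleftrightarrow> (par ^^ n) y = z"
  by (induction n arbitrary: y) (auto simp: funpow_swap1)

text \<open>
  The mass of the nodes of level \<open>n\<close> that violate the bound is at most \<open>1 / (n + 1)\<^sup>2\<close> below each root:
  at such a node the mass is smaller than \<open>1 / (n + 1)\<^sup>2\<close> times the geometric mean of itself and its
  modified volume, and the sum of these geometric means is bounded. There are only countably many
  roots.
\<close>
lemma AE_cell_mass_ge: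
  fixes M :: "'x measure" and c :: "nat \<Rightarrow> 'x \<Rightarrow> 'i"
  assumes M: "prob_space M"
    and countable: "countable (UNIV :: 'i set)"
    and cells [measurable]: "\<And>n z. {x \<in> space M. c n x = z} \<in> sets M"
    and nested: "\<And>n x. par (c (Suc n) x) = c n x"
    and mass: "\<And>n z. m n z = measure M {x \<in> space M. c n x = z}"
  shows "AE x in M. \<forall>\<^sub>F n in sequentially.
    gain ^ hole_count n (c n x) * (child_vol ^ n * \<kappa>) \<le> (real n + 1) ^ 4 * m n (c n x)"
proof -
  interpret prob_space M by fact
  have anc: "(par ^^ n) (c n x) = c 0 x" for n x
    by (induction n) (auto simp: funpow_swap1 nested)
  define bad where "bad n y \<longleftrightarrow> (real n + 1) ^ 4 * m n y < gain ^ hole_count n y * (child_vol ^ n * \<kappa>)" for n y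
  have root: "AE x in M. c 0 x = z \<longrightarrow> (\<forall>\<^sub>F n in sequentially. \<not> bad n (c n x))" for z
  proof -
    define E where "E n = (\<Union>y\<in>{y\<in>descendants n z. bad n y}. {x\<in>space M. c n x = y})" for n
    have fin: "finite {y\<in>descendants n z. bad n y}" for n using finite_descendants by simp
    have E [measurable]: "E n \<in> sets M" for n
      unfolding E_def using fin by (intro sets.finite_UN) auto
    have E_le: "measure M (E n) \<le> 1 / (real n + 1)\<^sup>2" for n
    proof -
      have "measure M (E n) \<le> (\<Sum>y\<in>{y\<in>descendants n z. bad n y}. m n y)"
        unfolding E_def mass using fin by (intro finite_measure_subadditive_finite) auto
      also have "\<dots> \<le> (\<Sum>y\<in>{y\<in>descendants n z. bad n y}.
          sqrt (gain ^ hole_count n y * (m n y * (child_vol ^ n * \<kappa>))) / (real n + 1)\<^sup>2)"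
      proof (rule sum_mono)
        fix y assume "y \<in> {y\<in>descendants n z. bad n y}"
        hence "m n y * ((real n + 1) ^ 4 * m n y) \<le> m n y * (gain ^ hole_count n y * (child_vol ^ n * \<kappa>))"
          using m_nonneg by (intro mult_left_mono) (auto simp: bad_def)
        also have "m n y * ((real n + 1) ^ 4 * m n y) = (m n y * (real n + 1)\<^sup>2)\<^sup>2"
          by (simp add: power2_eq_square power4_eq_xxxx)
        finally have "m n y * (real n + 1)\<^sup>2 \<le> sqrt (m n y * (gain ^ hole_count n y * (child_vol ^ n * \<kappa>)))"
          by (rule real_le_rsqrt)
        thus "m n y \<le> sqrt (gain ^ hole_count n y * (m n y * (child_vol ^ n * \<kappa>))) / (real n + 1)\<^sup>2"
          by (simp add: pos_le_divide_eq mult_ac)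
      qed
      also have "\<dots> \<le> (\<Sum>y\<in>descendants n z. sqrt (gain ^ hole_count n y * (m n y * (child_vol ^ n * \<kappa>))) / (real n + 1)\<^sup>2)"
        using gain_ge_1 m_nonneg child_vol_bounds kappa_bounds by (intro sum_mono2 finite_descendants) auto
      also have "\<dots> \<le> sqrt (m 0 z) / (real n + 1)\<^sup>2"
        unfolding sum_divide_distrib[symmetric] by (intro divide_right_mono sum_descendants_le) auto
      also have "\<dots> \<le> 1 / (real n + 1)\<^sup>2"
        by (intro divide_right_mono) (auto simp: mass)
      finally show ?thesis .
    qed
    have "summable (\<lambda>n. 1 / (real n + 1)\<^sup>2)"
      using inverse_squares_sums by (auto dest: sums_summable simp: add_ac)
    hence "summable (\<lambda>n. measure M (E n))"
      by (rule summable_comparison_test') (auto simp: E_le)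
    hence "AE x in M. \<forall>\<^sub>F n in sequentially. x \<in> space M - E n"
      by (intro borel_cantelli_AE1) (auto simp: emeasure_eq_measure)
    thus ?thesis
    proof eventually_elim
      case (elim x)
      show ?case
      proof
        assume "c 0 x = z"
        with elim show "\<forall>\<^sub>F n in sequentially. \<not> bad n (c n x)"
          by (auto simp: E_def descendants_iff anc elim: eventually_mono)
      qed
    qed
  qed
  have "AE x in M. \<forall>z\<in>UNIV. c 0 x = z \<longrightarrow> (\<forall>\<^sub>F n in sequentially. \<not> bad n (c n x))"
    using countable root by (subst AE_ball_countable) auto
  thus ?thesis
    by eventually_elim (auto simp: bad_def not_less)
qed

lemma hole_count_eq_card:
  assumes nested: "\<And>n. par (c (Suc n)) = c n"
  shows "hole_count n (c n) = card {i \<in> {0..<n}. hole i (c i) \<noteq> None}"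
proof (induction n)
  case (Suc n)
  have "{i \<in> {0..<Suc n}. hole i (c i) \<noteq> None} =
     {i \<in> {0..<n}. hole i (c i) \<noteq> None} \<union> (if hole n (c n) = None then {} else {n})"
    by (auto simp: less_Suc_eq)
  thus ?case using Suc by (auto simp: nested card_insert_if)
qed simp

end

section \<open>Local dimensions\<close>

lemma borel_measurable_measure_cball:
  fixes M :: "'a::{metric_space, second_countable_topology} measure"
  assumes M: "prob_space M" and sets: "sets M = sets borel"
  shows "(\<lambda>x. measure M (cball x r)) \<in> borel_measurable M"
proof -
  interpret prob_space M by fact
  let ?Q = "{p::'a \<times> 'a. dist (fst p) (snd p) \<le> r}"
  have "closed ?Q" by (intro closed_Collect_le continuous_intros)
  hence "?Q \<in> sets (borel \<Otimes>\<^sub>M borel)" unfolding borel_prod by (rule borel_closed)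
  moreover have "sets (M \<Otimes>\<^sub>M M) = sets (borel \<Otimes>\<^sub>M borel)"
    by (intro sets_pair_measure_cong sets)
  ultimately have "(\<lambda>x. emeasure M (Pair x -` ?Q)) \<in> borel_measurable M"
    by (intro measurable_emeasure_Pair) simp
  moreover have "Pair x -` ?Q = cball x r" for x by auto
  ultimately show ?thesis by (simp add: measure_def)
qed

text \<open>
  As a function of the radius, the measure of a ball is a distribution function.
\<close>
lemma measure_cball_right_continuous:
  fixes M :: "'a::{metric_space, second_countable_topology} measure"
  assumes M: "prob_space M" and sets: "sets M = sets borel"
  shows "((\<lambda>r. measure M (cball x r)) \<longlongrightarrow> measure M (cball x s)) (at_right s)"
proof -
  interpret prob_space M by fact
  have d [measurable]: "dist x \<in> borel_measurable M"
    by (subst measurable_cong_sets[OF sets refl]) (intro borel_measurable_continuous_onI continuous_intros)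
  interpret D: real_distribution "distr M borel (dist x)"
    by (intro real_distribution.intro real_distribution_axioms.intro prob_space_distr d) auto
  have "cdf (distr M borel (dist x)) = (\<lambda>r. measure M (cball x r))"
    using sets_eq_imp_space_eq[OF sets]
    by (simp add: cdf_def measure_distr vimage_def cball_def fun_eq_iff)
  with D.cdf_is_right_cont[of s] show ?thesis
    by (simp add: continuous_within)
qed

text \<open>
  By right continuity in the radius, the limit superior can be computed along rational radii. A ball
  of measure zero, where right continuity of the quotient fails because of \<open>ln 0 = 0\<close>, contributes
  the value \<open>0\<close>, and all quotients for radii below \<open>1\<close> are nonnegative.
\<close>
lemma upper_local_dim_measurable:
  fixes M :: "'a::{metric_space, second_countable_topology} measure"
  assumes M: "prob_space M" and sets: "sets M = sets borel"
  shows "upper_local_dim M \<in> borel_measurable M"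
proof -
  interpret prob_space M by fact
  define f where "f x r = ereal (ln (measure M (cball x r)) / ln r)" for x r
  define I where "I n = {q\<in>\<rat>. 0 < q \<and> q < 1 / (real n + 2)}" for n
  have nonneg: "0 \<le> f x r" if "0 < r" "r < 1" for x r
  proof -
    have "ln (measure M (cball x r)) \<le> 0"
      by (cases "measure M (cball x r) = 0") (auto simp: zero_less_measure_iff)
    thus ?thesis using that by (auto simp: f_def intro!: divide_nonpos_neg)
  qed
  have small: "1 / (real n + 2) < 1" for n :: nat by simp
  have f_le: "f x s \<le> (SUP q\<in>I n. f x q)" if s: "0 < s" "s < 1 / (real n + 2)" for x s n
  proof (rule ccontr)
    assume "\<not> ?thesis"
    then obtain y where y: "(SUP q\<in>I n. f x q) < y" "y < f x s"
      using dense[of "SUP q\<in>I n. f x q" "f x s"] by (auto simp: not_le)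
    have s1: "s < 1" using s(2) small[of n] by (rule less_trans)
    have "\<forall>\<^sub>F r in at_right s. y < f x r"
    proof (cases "measure M (cball x s) = 0")
      case True
      have "\<forall>\<^sub>F r in at_right s. s < r \<and> r < 1"
        using s1 by (auto simp: eventually_at_right_field)
      thus ?thesis
      proof eventually_elim
        case (elim r)
        have "y < 0" using y(2) True by (simp add: f_def zero_ereal_def)
        also have "0 \<le> f x r" using elim s by (intro nonneg) auto
        finally show ?case .
      qed
    next
      case False
      have "(f x \<longlongrightarrow> f x s) (at_right s)"
        unfolding f_def using s s1 False
        by (intro tendsto_intros measure_cball_right_continuous[OF M sets]) auto
      thus ?thesis using y(2) by (rule order_tendstoD)
    qed
    then obtain b where b: "b > s" "\<And>r. s < r \<Longrightarrow> r < b \<Longrightarrow> y < f x r"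
      by (auto simp: eventually_at_right_field)
    obtain q where q: "q \<in> \<rat>" "s < q" "q < min b (1 / (real n + 2))"
      using Rats_dense_in_real[of s "min b (1 / (real n + 2))"] b(1) s by auto
    hence "q \<in> I n" using s by (auto simp: I_def)
    hence "f x q \<le> (SUP q\<in>I n. f x q)" by (intro SUP_upper)
    moreover have "y < f x q" using q by (intro b) auto
    ultimately show False using y by auto
  qed
  have eq: "upper_local_dim M x = (INF n. SUP q\<in>I n. f x q)" for x
  proof (rule antisym)
    show "upper_local_dim M x \<le> (INF n. SUP q\<in>I n. f x q)"
    proof (rule INF_greatest)
      fix n :: nat
      have "\<forall>\<^sub>F s in at_right 0. 0 < s \<and> s < 1 / (real n + 2)"
        by (auto simp: eventually_at_right_field intro!: exI[of _ "1 / (real n + 2)"])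
      hence "\<forall>\<^sub>F s in at_right 0. f x s \<le> (SUP q\<in>I n. f x q)"
        by eventually_elim (auto intro: f_le)
      thus "upper_local_dim M x \<le> (SUP q\<in>I n. f x q)"
        unfolding upper_local_dim_def f_def by (rule Limsup_bounded)
    qed
    show "(INF n. SUP q\<in>I n. f x q) \<le> upper_local_dim M x"
      unfolding upper_local_dim_def Limsup_def
    proof (rule INF_greatest)
      fix P assume "P \<in> {P. eventually P (at_right (0::real))}"
      then obtain b :: real where b: "b > 0" "\<And>r. 0 < r \<Longrightarrow> r < b \<Longrightarrow> P r"
        by (auto simp: eventually_at_right_field)
      obtain n where n: "1 / real (Suc n) < b" using b(1) nat_approx_posE by blast
      have "1 / (real n + 2) \<le> 1 / real (Suc n)" by (intro divide_left_mono) auto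
      hence "I n \<subseteq> Collect P" using n b by (auto simp: I_def)
      thus "(INF n. SUP q\<in>I n. f x q) \<le> Sup ((\<lambda>r. ereal (ln (measure M (cball x r)) / ln r)) ` Collect P)"
        by (intro INF_lower2[of n]) (auto simp: f_def intro: SUP_subset_mono)
    qed
  qed
  have cI: "countable (I n)" for n
    using countable_rat by (rule countable_subset[rotated]) (auto simp: I_def)
  have [measurable]: "(\<lambda>x. f x q) \<in> borel_measurable M" for q
    unfolding f_def using borel_measurable_measure_cball[OF M sets, of q] by measurable
  have "(\<lambda>x. INF n. SUP q\<in>I n. f x q) \<in> borel_measurable M"
    using cI by measurable
  thus ?thesis unfolding eq[abs_def] eq by (simp add: eq)
qed

text \<open>
  Passage from the discrete radii \<open>K / 2 ^ n\<close> to all radii. A given \<open>r < K\<close> is compared with the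
  largest radius \<open>K / 2 ^ n\<close> that does not exceed it; the polynomial factor and the bounded change of
  radius disappear in the logarithmic limit.
\<close>
lemma upper_local_dim_le:
  fixes M :: "'a::{metric_space, second_countable_topology} measure" and h \<kappa> K \<eta> :: real
  assumes M: "prob_space M" and sets: "sets M = sets borel"
    and K: "0 < K" and \<kappa>: "0 < \<kappa>" and h: "0 \<le> h"
    and mass: "\<forall>\<^sub>F n in sequentially. exp (h * real (card {i\<in>{0..<n}. P i})) * \<kappa> / 2 ^ (n * d)
       \<le> (real n + 1) ^ 4 * measure M (cball x (K / 2 ^ n))"
    and freq: "ereal \<eta> \<le> liminf (\<lambda>n. ereal (1 / real n * real (card {i\<in>{0..<n}. P i})))"
  shows "upper_local_dim M x \<le> ereal (real d - \<eta> * h / ln 2)"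
proof -
  interpret prob_space M by fact
  have below: "upper_local_dim M x \<le> ereal (real d - \<tau> * h / ln 2)" if \<tau>: "\<tau> < \<eta>" for \<tau>
  proof -
    \<comment> \<open>\<open>A n\<close> bounds \<open>- ln\<close> of the measure and \<open>D n\<close> bounds \<open>- ln\<close> of the radius at level \<open>n\<close>.\<close>
    define A where "A n = real n * (real d * ln 2 - \<tau> * h) + 4 * ln (real n + 1) - ln \<kappa>" for n :: nat
    define D where "D n = (real n - 1) * ln 2 - ln K" for n :: nat
    have lim: "(\<lambda>n. A n / D n) \<longlonglongrightarrow> real d - \<tau> * h / ln 2"
    proof -
      define s where "s = real d * ln 2 - \<tau> * h"
      have "(\<lambda>n. (real n * s + 4 * ln (real n + 1) - ln \<kappa>) / ((real n - 1) * ln 2 - ln K)) \<longlonglongrightarrow> s / ln 2"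
        by (real_asymp simp: divide_inverse)
      thus ?thesis by (simp add: A_def[abs_def] D_def[abs_def] s_def diff_divide_distrib)
    qed
    define N where "N r = nat \<lceil>log 2 (K / r)\<rceil>" for r
    have N: "filterlim N sequentially (at_right 0)"
      unfolding N_def using K by real_asymp
    have D: "\<forall>\<^sub>F n in sequentially. 0 < D n"
      unfolding D_def by real_asymp
    have "\<forall>\<^sub>F n in sequentially. ereal \<tau> < ereal (1 / real n * real (card {i\<in>{0..<n}. P i}))"
      using \<tau> by (intro less_LiminfD less_le_trans[OF _ freq]) simp
    hence card: "\<forall>\<^sub>F n in sequentially. \<tau> * real n \<le> real (card {i\<in>{0..<n}. P i})"
      using eventually_gt_at_top[of 0] by eventually_elim (simp add: field_simps)
    have *: "\<forall>\<^sub>F n in sequentially. 0 < D n \<and> 0 < measure M (cball x (K / 2 ^ n)) \<and>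
        - ln (measure M (cball x (K / 2 ^ n))) \<le> A n"
      using D card mass
    proof eventually_elim
      case (elim n)
      let ?c = "real (card {i\<in>{0..<n}. P i})" and ?m = "measure M (cball x (K / 2 ^ n))"
      have pos: "0 < exp (h * ?c) * \<kappa> / 2 ^ (n * d)" using \<kappa> by simp
      hence "0 < (real n + 1) ^ 4 * ?m" using elim(3) by linarith
      hence m: "0 < ?m" by (simp add: zero_less_mult_iff)
      have "ln (exp (h * ?c) * \<kappa> / 2 ^ (n * d)) \<le> ln ((real n + 1) ^ 4 * ?m)"
        using elim(3) pos by simp
      hence "h * ?c + ln \<kappa> - real n * real d * ln 2 \<le> 4 * ln (real n + 1) + ln ?m"
        using \<kappa> m by (simp add: ln_mult ln_div ln_realpow)
      moreover have "h * (\<tau> * real n) \<le> h * ?c" using elim(2) h by (rule mult_left_mono)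
      ultimately show ?case using elim m by (simp add: A_def algebra_simps)
    qed
    have r: "\<forall>\<^sub>F r in at_right 0. 0 < r \<and> r < min 1 K"
      using K by (intro eventually_at_rightI[of 0 "min 1 K"]) auto
    have "\<forall>\<^sub>F r in at_right 0. ereal (ln (measure M (cball x r)) / ln r) \<le> ereal (A (N r) / D (N r))"
      using r eventually_compose_filterlim[OF * N]
    proof eventually_elim
      case (elim r)
      let ?n = "N r" and ?m = "measure M (cball x r)"
      have "log 2 (K / r) \<le> real ?n" by (simp add: N_def real_nat_ceiling_ge)
      hence "ln (K / r) / ln 2 \<le> real ?n" by (simp add: log_def)
      hence "ln (K / r) \<le> ln (2 ^ ?n)" by (simp add: ln_realpow field_simps)
      hence "K / r \<le> 2 ^ ?n" using elim K by (simp del: ln_realpow)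
      hence "K / 2 ^ ?n \<le> r" using elim by (simp add: field_simps)
      hence sub: "measure M (cball x (K / 2 ^ ?n)) \<le> ?m"
        by (intro finite_measure_mono) (auto simp: sets)
      hence m: "0 < ?m" using elim by linarith
      have "ln (measure M (cball x (K / 2 ^ ?n))) \<le> ln ?m" using sub elim m by simp
      hence A: "- ln ?m \<le> A ?n" using elim by linarith
      have "0 < log 2 (K / r)" using elim by simp
      hence "real ?n < log 2 (K / r) + 1" unfolding N_def by linarith
      hence "(real ?n - 1) * ln 2 < ln (K / r)" by (simp add: log_def field_simps)
      hence Dn: "D ?n < - ln r" using elim K by (simp add: D_def ln_div)
      have "ln ?m \<le> 0" using m by simp
      have "ln ?m / ln r = (- ln ?m) / (- ln r)" by simp
      also have "\<dots> \<le> A ?n / D ?n"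
        using A Dn elim \<open>ln ?m \<le> 0\<close> by (intro frac_le) auto
      finally show ?case by simp
    qed
    hence "upper_local_dim M x \<le> Limsup (at_right 0) (\<lambda>r. ereal (A (N r) / D (N r)))"
      unfolding upper_local_dim_def by (rule Limsup_mono)
    also have "\<dots> = ereal (real d - \<tau> * h / ln 2)"
      by (intro lim_imp_Limsup tendsto_ereal filterlim_compose[OF lim N]) auto
    finally show ?thesis .
  qed
  have "(\<lambda>n. ereal (real d - (\<eta> - 1 / real (Suc n)) * h / ln 2)) \<longlonglongrightarrow> ereal (real d - (\<eta> - 0) * h / ln 2)"
    by (intro tendsto_intros LIMSEQ_inverse_real_of_nat[unfolded inverse_eq_divide]) auto
  thus ?thesis
    by (intro LIMSEQ_le_const[where X = "\<lambda>n. ereal (real d - (\<eta> - 1 / real (Suc n)) * h / ln 2)"])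
       (auto intro!: below simp del: of_nat_Suc)
qed

section \<open>Dyadic grids and their shifts\<close>

text \<open>
  As \<open>2 ^ i\<close> is invertible modulo \<open>M\<close>, the numbers \<open>2 ^ i * w\<close> run through all residues, so that the
  points in question are, modulo \<open>1\<close>, equally spaced with step \<open>1 / M\<close>. The \<open>c\<close> points after the first
  one to the right of \<open>\<beta>\<close> stay below \<open>\<beta> + c / M \<le> 1 - \<beta>\<close>.
\<close>
lemma card_central_shifts:
  fixes M c i :: nat and \<beta> \<theta> :: real
  assumes M: "odd M" and c: "real c \<le> real M * (1 - 2 * \<beta>)" and \<beta>: "0 \<le> \<beta>"
  shows "c \<le> card {w\<in>{..<M}. frac (2 ^ i * (\<theta> + real w / real M)) \<in> {\<beta>..<1 - \<beta>}}"
proof -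
  have M0: "0 < M" using M odd_pos by blast
  have "real c \<le> real M * 1" by (rule order_trans[OF c mult_left_mono]) (use \<beta> in auto)
  hence cM: "c \<le> M" by simp
  have "coprime (2 ^ i) (int M)" using M by simp
  then obtain u where u: "[2 ^ i * u = 1] (mod int M)" using cong_solve_coprime_int by blast
  define a where "a = \<lceil>real M * (\<beta> - 2 ^ i * \<theta>)\<rceil>"
  define f where "f j = nat ((u * (a + int j)) mod int M)" for j
  have f: "int (f j) = (u * (a + int j)) mod int M" for j using M0 by (simp add: f_def)
  have hit: "[2 ^ i * int (f j) = a + int j] (mod int M)" for j
  proof -
    have "[2 ^ i * int (f j) = 2 ^ i * (u * (a + int j))] (mod int M)"
      unfolding f by (intro cong_mult cong_refl) (simp add: cong_def)
    also have "2 ^ i * (u * (a + int j)) = (2 ^ i * u) * (a + int j)" by simp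
    also have "[\<dots> = 1 * (a + int j)] (mod int M)" by (intro cong_mult u cong_refl)
    finally show ?thesis by simp
  qed
  have "inj_on f {..<c}"
  proof (rule inj_onI)
    fix j j' assume jj: "j \<in> {..<c}" "j' \<in> {..<c}" "f j = f j'"
    have "[a + int j = a + int j'] (mod int M)"
      using hit[of j] hit[of j'] jj(3) by (metis cong_sym cong_trans)
    hence "[int j = int j'] (mod int M)" by (simp add: cong_add_lcancel)
    hence "[j = j'] (mod M)" by (simp add: cong_int_iff)
    thus "j = j'" using jj cM by (auto simp: cong_def)
  qed
  moreover have "f ` {..<c} \<subseteq> {w\<in>{..<M}. frac (2 ^ i * (\<theta> + real w / real M)) \<in> {\<beta>..<1 - \<beta>}}"
  proof safe
    fix j assume j: "j < c"
    show "f j < M" using f[of j] M0 by (metis of_nat_less_iff pos_mod_bound of_nat_0_less_iff)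
    obtain t where t: "2 ^ i * int (f j) = a + int j + int M * t"
      using cong_sym[OF hit[of j]] by (auto simp: cong_iff_lin)
    define y where "y = 2 ^ i * \<theta> + (of_int a + real j) / real M"
    have "real_of_int (2 ^ i * int (f j)) = real_of_int (a + int j + int M * t)" using t by simp
    hence "2 ^ i * real (f j) = of_int a + real j + real M * of_int t" by simp
    hence "2 ^ i * (\<theta> + real (f j) / real M) = y + of_int t"
      using M0 by (simp add: y_def field_simps)
    hence fr: "frac (2 ^ i * (\<theta> + real (f j) / real M)) = frac y" by simp
    have "real M * (\<beta> - 2 ^ i * \<theta>) \<le> of_int a" "of_int a < real M * (\<beta> - 2 ^ i * \<theta>) + 1"
      unfolding a_def by linarith+
    moreover have "real j + 1 \<le> real c" using j by simp
    moreover have "real M * y = real M * (2 ^ i * \<theta>) + of_int a + real j"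
      unfolding y_def distrib_left using M0 by simp
    ultimately have "real M * \<beta> \<le> real M * y" "real M * y < real M * (1 - \<beta>)"
      using c by (simp_all add: algebra_simps)
    hence "\<beta> \<le> y" "y < 1 - \<beta>" using M0 by auto
    moreover from this have "frac y = y" using \<beta> by (simp add: frac_eq)
    ultimately show "frac (2 ^ i * (\<theta> + real (f j) / real M)) \<in> {\<beta>..<1 - \<beta>}" by (simp add: fr)
  qed
  ultimately have "card {..<c} \<le> card {w\<in>{..<M}. frac (2 ^ i * (\<theta> + real w / real M)) \<in> {\<beta>..<1 - \<beta>}}"
    by (intro card_inj_on_le[of f]) auto
  thus ?thesis by simp
qed

definition shifts :: "nat \<Rightarrow> ('n \<Rightarrow> nat) set" where
  "shifts M = Pi UNIV (\<lambda>_. {..<M})"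

lemma card_funs: "card (Pi UNIV A :: ('n::finite \<Rightarrow> 'b) set) = (\<Prod>a\<in>UNIV. card (A a))"
  using card_PiE[of "UNIV :: 'n set" A] by (simp add: PiE_UNIV_domain)

lemma finite_shifts: "finite (shifts M :: ('n::finite \<Rightarrow> nat) set)"
  using finite_PiE[of "UNIV :: 'n set" "\<lambda>_. {..<M}"] by (simp add: shifts_def PiE_UNIV_domain)

lemma card_shifts: "card (shifts M :: ('n::finite \<Rightarrow> nat) set) = M ^ CARD('n)"
  by (simp add: shifts_def card_funs)

text \<open>
  The index of the half-open cube with side length \<open>L / 2 ^ i\<close> that contains \<open>x\<close>, in the dyadic grid
  shifted by \<open>- L * w / M\<close>.
\<close>
definition cell :: "real \<Rightarrow> nat \<Rightarrow> ('n::finite \<Rightarrow> nat) \<Rightarrow> nat \<Rightarrow> real ^ 'n \<Rightarrow> 'n \<Rightarrow> int" where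
  "cell L M w i x = (\<lambda>a. \<lfloor>2 ^ i * (x $ a / L + real (w a) / real M)\<rfloor>)"

definition parent :: "('n \<Rightarrow> int) \<Rightarrow> 'n \<Rightarrow> int" where "parent z = (\<lambda>a. z a div 2)"

lemma parent_cell: "parent (cell L M w (Suc i) x) = cell L M w i x"
proof
  fix a
  have "\<lfloor>(2 ^ Suc i * (x $ a / L + real (w a) / real M)) / real_of_int 2\<rfloor>
      = \<lfloor>2 ^ Suc i * (x $ a / L + real (w a) / real M)\<rfloor> div 2"
    by (rule floor_divide_real_eq_div) simp
  thus "parent (cell L M w (Suc i) x) a = cell L M w i x a"
    by (simp add: parent_def cell_def)
qed

lemma ancestor_cell: "(parent ^^ j) (cell L M w (i + j) x) = cell L M w i x"
  by (induction j) (auto simp: funpow_swap1 parent_cell)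

lemma card_parent_vimage: "card (parent -` {z} :: ('n::finite \<Rightarrow> int) set) = 2 ^ CARD('n)"
proof -
  have "b div 2 = c \<longleftrightarrow> b = 2 * c \<or> b = 2 * c + 1" for b c :: int by presburger
  hence "parent -` {z} = Pi UNIV (\<lambda>a. {2 * z a, 2 * z a + 1})"
    by (auto simp: parent_def fun_eq_iff Pi_def)
  thus ?thesis by (simp add: card_funs numeral_2_eq_2)
qed

text \<open>
  The distance of \<open>x\<close> from the faces of its cell is at least \<open>1 / 2 ^ i\<close>, that is, the fraction \<open>1 / L\<close>
  of the side length.
\<close>
definition central :: "real \<Rightarrow> nat \<Rightarrow> ('n::finite \<Rightarrow> nat) \<Rightarrow> nat \<Rightarrow> real ^ 'n \<Rightarrow> bool" where
  "central L M w i x \<longleftrightarrow>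
     (\<forall>a. frac (2 ^ i * (x $ a / L + real (w a) / real M)) \<in> {1 / L..<1 - 1 / L})"

lemma card_central:
  fixes x :: "real ^ 'n::finite"
  assumes "odd M" "real c \<le> real M * (1 - 2 / L)" "0 < L"
  shows "c ^ CARD('n) \<le> card {w\<in>shifts M. central L M w i x}"
proof -
  have "{w\<in>shifts M. central L M w i x} =
    Pi UNIV (\<lambda>a. {w\<in>{..<M}. frac (2 ^ i * (x $ a / L + real w / real M)) \<in> {1 / L..<1 - 1 / L}})"
    by (auto simp: shifts_def central_def Pi_def)
  hence "card {w\<in>shifts M. central L M w i x} =
    (\<Prod>a\<in>UNIV. card {w\<in>{..<M}. frac (2 ^ i * (x $ a / L + real w / real M)) \<in> {1 / L..<1 - 1 / L}})"
    by (simp add: card_funs)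
  moreover have "(\<Prod>a\<in>(UNIV :: 'n set). c) \<le> \<dots>"
    using assms by (intro prod_mono conjI card_central_shifts) auto
  ultimately show ?thesis by simp
qed

text \<open>
  Double counting: by \<open>card_central\<close> the average over the shifts has the stated size.
\<close>
lemma exists_good_shift:
  fixes x :: "real ^ 'n::finite"
  assumes M: "odd M" and c: "real c \<le> real M * (1 - 2 / L)" and L: "0 < L" and I: "finite I"
  shows "\<exists>w\<in>shifts M. (real c / real M) ^ CARD('n) * real (card I) \<le> real (card {i\<in>I. central L M w i x})"
proof (rule ccontr)
  assume neg: "\<not> ?thesis"
  let ?W = "shifts M :: ('n \<Rightarrow> nat) set" and ?p = "(real c / real M) ^ CARD('n)"
  have M0: "0 < M" using M odd_pos by blast
  have W: "finite ?W" "?W \<noteq> {}"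
    using finite_shifts card_shifts[of M, where 'n = 'n] M0 by auto
  have "(\<Sum>w\<in>?W. real (card {i\<in>I. central L M w i x})) < (\<Sum>w\<in>?W. ?p * real (card I))"
    using neg W by (intro sum_strict_mono) (auto simp: not_le)
  also have "\<dots> = real c ^ CARD('n) * real (card I)"
    using M0 by (simp add: card_shifts power_divide)
  also have "\<dots> = (\<Sum>i\<in>I. real (c ^ CARD('n)))" by simp
  also have "\<dots> \<le> (\<Sum>i\<in>I. real (card {w\<in>?W. central L M w i x}))"
    using card_central[OF M c L] by (intro sum_mono) (simp del: of_nat_power)
  also have "\<dots> = (\<Sum>i\<in>I. \<Sum>w\<in>?W. if central L M w i x then 1 else 0)"
    using W by (simp add: sum.If_cases Int_def)
  also have "\<dots> = (\<Sum>w\<in>?W. \<Sum>i\<in>I. if central L M w i x then 1 else 0)" by (rule sum.swap)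
  also have "\<dots> = (\<Sum>w\<in>?W. real (card {i\<in>I. central L M w i x}))"
    using I by (simp add: sum.If_cases Int_def)
  finally show False by simp
qed

lemma cell_eq_of_central:
  assumes "central L M w i x" "0 < L" "y \<in> cball x (1 / 2 ^ i)"
  shows "cell L M w i y = cell L M w i x"
proof
  fix a
  define s where "s = 2 ^ i * (x $ a / L + real (w a) / real M)"
  define t where "t = 2 ^ i * (y $ a / L + real (w a) / real M)"
  have "\<bar>y $ a - x $ a\<bar> \<le> 1 / 2 ^ i"
    using component_le_norm_cart[of "y - x" a] assms(3) by (simp add: dist_norm norm_minus_commute)
  hence "2 ^ i * \<bar>y $ a - x $ a\<bar> / L \<le> 1 / L"
    using assms(2) by (intro divide_right_mono) (auto simp: field_simps)
  also have "2 ^ i * \<bar>y $ a - x $ a\<bar> / L = \<bar>2 ^ i * (y $ a - x $ a) / L\<bar>"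
    using assms(2) by (simp only: abs_mult abs_divide power_abs abs_numeral abs_of_pos)
  also have "2 ^ i * (y $ a - x $ a) / L = t - s"
    unfolding s_def t_def by (simp add: diff_divide_distrib algebra_simps)
  finally have "\<bar>t - s\<bar> \<le> 1 / L" .
  moreover have "1 / L \<le> frac s" "frac s < 1 - 1 / L"
    using assms(1) by (auto simp: central_def s_def)
  ultimately have "of_int \<lfloor>s\<rfloor> \<le> t" "t < of_int \<lfloor>s\<rfloor> + 1" by (auto simp: frac_def)
  hence "\<lfloor>t\<rfloor> = \<lfloor>s\<rfloor>" by linarith
  thus "cell L M w i y a = cell L M w i x a" by (simp add: cell_def s_def t_def)
qed

lemma dist_le_of_same_cell:
  fixes x y :: "real ^ 'n::finite"
  assumes "cell L M w i y = cell L M w i x" "0 < L"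
  shows "dist x y \<le> L * sqrt (real CARD('n)) / 2 ^ i"
proof -
  have "\<bar>(y - x) $ a\<bar> \<le> L / 2 ^ i" for a
  proof -
    define s where "s = 2 ^ i * (x $ a / L + real (w a) / real M)"
    define t where "t = 2 ^ i * (y $ a / L + real (w a) / real M)"
    have "\<lfloor>t\<rfloor> = \<lfloor>s\<rfloor>" using assms(1) by (simp add: cell_def fun_eq_iff s_def t_def)
    hence "\<bar>t - s\<bar> \<le> 1" by linarith
    moreover have "t - s = 2 ^ i * ((y $ a - x $ a) / L)"
      by (simp add: s_def t_def algebra_simps diff_divide_distrib)
    ultimately have "2 ^ i * (\<bar>y $ a - x $ a\<bar> / L) \<le> 1"
      using assms(2) by (simp only: abs_mult abs_divide power_abs abs_numeral abs_of_pos)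
    thus ?thesis using assms(2) by (simp add: field_simps)
  qed
  hence "norm (y - x) \<le> sqrt (real CARD('n)) * (L / 2 ^ i)"
    using L2_set_mono[of "UNIV :: 'n set" "\<lambda>a. norm ((y - x) $ a)" "\<lambda>a. L / 2 ^ i"] assms(2)
    by (simp add: norm_vec_def L2_set_constant)
  thus ?thesis by (simp add: dist_norm norm_minus_commute mult_ac)
qed

section \<open>From porosity to holes in a grid\<close>

text \<open>
  Neither the supremum in the definition of \<open>por\<close> nor the infimum inside need be attained. Both
  the radius and the mass of the hole are therefore relaxed.
\<close>
lemma porous_imp_hole:
  fixes M :: "'a::metric_space measure"
  assumes M: "prob_space M" and sets: "sets M = sets borel"
    and por: "ereal \<alpha> \<le> por M x s \<epsilon>" and \<beta>: "\<beta> < \<alpha>" and \<epsilon>: "\<epsilon> < \<delta>" and s: "0 < s"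
  shows "\<exists>y. cball y (\<beta> * s) \<subseteq> cball x s \<and> measure M (cball y (\<beta> * s)) \<le> \<delta> * measure M (cball x s)"
proof -
  interpret prob_space M by fact
  have "ereal \<beta> < por M x s \<epsilon>" by (rule less_le_trans[OF _ por]) (simp add: \<beta>)
  then obtain a where a: "\<beta> < a" and inf:
      "(INF y \<in> {y. cball y (a * s) \<subseteq> cball x s}.
          ereal (measure M (cball y (a * s)) / measure M (cball x s))) \<le> ereal \<epsilon>"
    unfolding por_def by (auto simp: less_SUP_iff)
  note inf
  also have "ereal \<epsilon> < ereal \<delta>" using \<epsilon> by simp
  finally obtain y where y: "cball y (a * s) \<subseteq> cball x s"
      "measure M (cball y (a * s)) / measure M (cball x s) < \<delta>"
    unfolding INF_less_iff by auto
  have sub: "cball y (\<beta> * s) \<subseteq> cball y (a * s)" using a s by (intro subset_cball mult_right_mono) auto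
  have le: "measure M (cball y (\<beta> * s)) \<le> measure M (cball y (a * s))"
    using sub by (intro finite_measure_mono) (auto simp: sets)
  have "measure M (cball y (a * s)) \<le> \<delta> * measure M (cball x s)"
  proof (cases "measure M (cball x s) = 0")
    case True
    have "measure M (cball y (a * s)) \<le> measure M (cball x s)"
      using y by (intro finite_measure_mono) (auto simp: sets)
    thus ?thesis using True by simp
  next
    case False
    hence "0 < measure M (cball x s)" by (simp add: zero_less_measure_iff)
    thus ?thesis using y(2) by (simp add: divide_less_eq)
  qed
  thus ?thesis using le sub y(1) by (intro exI[of _ y]) auto
qed

definition cell_mass :: "(real ^ 'n::finite) measure \<Rightarrow> real \<Rightarrow> nat \<Rightarrow> ('n \<Rightarrow> nat) \<Rightarrow> nat \<Rightarrow> ('n \<Rightarrow> int) \<Rightarrow> real"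
  where "cell_mass \<mu> L M w n z = measure \<mu> {x. cell L M w n x = z}"

definition light_descendant ::
  "(real ^ 'n::finite) measure \<Rightarrow> real \<Rightarrow> nat \<Rightarrow> ('n \<Rightarrow> nat) \<Rightarrow> nat \<Rightarrow> real \<Rightarrow> nat \<Rightarrow> ('n \<Rightarrow> int) \<Rightarrow> ('n \<Rightarrow> int) \<Rightarrow> bool"
  where "light_descendant \<mu> L M w k \<epsilon> n z R \<longleftrightarrow>
    (parent ^^ k) R = z \<and> cell_mass \<mu> L M w (n + k) R \<le> \<epsilon> * cell_mass \<mu> L M w n z"

definition grid_hole ::
  "(real ^ 'n::finite) measure \<Rightarrow> real \<Rightarrow> nat \<Rightarrow> ('n \<Rightarrow> nat) \<Rightarrow> nat \<Rightarrow> real \<Rightarrow> nat \<Rightarrow> ('n \<Rightarrow> int) \<Rightarrow> ('n \<Rightarrow> int) option"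
  where "grid_hole \<mu> L M w k \<epsilon> n z =
    (if \<exists>R. light_descendant \<mu> L M w k \<epsilon> n z R then Some (SOME R. light_descendant \<mu> L M w k \<epsilon> n z R) else None)"

lemma cell_sets: "{x. cell L M w n x = z} \<in> sets (borel :: (real ^ 'n::finite) measure)"
proof -
  have "{x::real ^ 'n. cell L M w n x = z} =
     {x\<in>space borel. \<forall>a. \<lfloor>2 ^ n * (x $ a / L + real (w a) / real M)\<rfloor> = z a}"
    by (auto simp: cell_def)
  also have "\<dots> \<in> sets borel" by measurable
  finally show ?thesis .
qed

lemma cell_mass_children:
  fixes \<mu> :: "(real ^ 'n::finite) measure"
  assumes "prob_space \<mu>" "sets \<mu> = sets borel"
  shows "cell_mass \<mu> L M w n z = (\<Sum>y\<in>parent -` {z}. cell_mass \<mu> L M w (Suc n) y)"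
proof -
  interpret prob_space \<mu> by fact
  have "{x. cell L M w n x = z} = (\<Union>y\<in>parent -` {z}. {x. cell L M w (Suc n) x = y})"
    by (auto simp: parent_cell)
  moreover have "finite (parent -` {z} :: ('n \<Rightarrow> int) set)"
    by (rule card_ge_0_finite) (simp add: card_parent_vimage)
  ultimately show ?thesis unfolding cell_mass_def
    using assms(2) cell_sets
    by (auto intro!: finite_measure_finite_Union simp: disjoint_family_on_def)
qed

lemma holed_tree_grid:
  fixes \<mu> :: "(real ^ 'n::finite) measure"
  assumes "prob_space \<mu>" "sets \<mu> = sets borel" "0 < k" "0 < \<epsilon>" "\<epsilon> \<le> (1 / 2 ^ CARD('n)) ^ k"
  shows "holed_tree parent (2 ^ CARD('n)) k (cell_mass \<mu> L M w) \<epsilon> (grid_hole \<mu> L M w k \<epsilon>)"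
proof
  fix n z R
  assume "grid_hole \<mu> L M w k \<epsilon> n z = Some R"
  hence "light_descendant \<mu> L M w k \<epsilon> n z R"
    by (metis grid_hole_def option.distinct(1) option.inject someI_ex)
  thus "(parent ^^ k) R = z" "cell_mass \<mu> L M w (n + k) R \<le> \<epsilon> * cell_mass \<mu> L M w n z"
    by (auto simp: light_descendant_def)
next
  show "cell_mass \<mu> L M w n z = (\<Sum>y\<in>parent -` {z}. cell_mass \<mu> L M w (Suc n) y)" for n z
    by (rule cell_mass_children[OF assms(1,2)])
  show "0 \<le> cell_mass \<mu> L M w n z" for n z by (simp add: cell_mass_def)
qed (use assms in \<open>simp_all add: card_parent_vimage\<close>)

text \<open>
  The ball around \<open>x\<close> lies in the cell of \<open>x\<close>, and the cell \<open>k\<close> levels below that contains the centre of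
  the porosity ball has small enough diameter to lie in that ball.
\<close>
lemma porous_central_imp_grid_hole:
  fixes \<mu> :: "(real ^ 'n::finite) measure"
  assumes M: "prob_space \<mu>" and sets: "sets \<mu> = sets borel"
    and por: "ereal \<alpha> \<le> por \<mu> x (2 powr - real i) \<epsilon>" and \<epsilon>: "\<epsilon> < \<delta>" "0 < \<delta>" and L: "0 < L"
    and k: "L * sqrt (real CARD('n)) / 2 ^ k < \<alpha>" and central: "central L M w i x"
  shows "grid_hole \<mu> L M w k \<delta> i (cell L M w i x) \<noteq> None"
proof -
  interpret prob_space \<mu> by fact
  define \<beta> where "\<beta> = L * sqrt (real CARD('n)) / 2 ^ k"
  have s: "2 powr - real i = 1 / 2 ^ i" by (simp add: powr_minus powr_realpow divide_inverse)
  obtain y where y: "cball y (\<beta> * (1 / 2 ^ i)) \<subseteq> cball x (1 / 2 ^ i)"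
      "measure \<mu> (cball y (\<beta> * (1 / 2 ^ i))) \<le> \<delta> * measure \<mu> (cball x (1 / 2 ^ i))"
    using porous_imp_hole[OF M sets por, of \<beta> \<delta>] k \<epsilon> by (auto simp: s \<beta>_def)
  have "0 \<le> \<beta>" using L by (simp add: \<beta>_def)
  hence "y \<in> cball y (\<beta> * (1 / 2 ^ i))" by simp
  hence "y \<in> cball x (1 / 2 ^ i)" using y(1) by blast
  hence cell_y: "cell L M w i y = cell L M w i x" by (rule cell_eq_of_central[OF central L])
  have "cell_mass \<mu> L M w (i + k) (cell L M w (i + k) y) \<le> measure \<mu> (cball y (\<beta> * (1 / 2 ^ i)))"
    unfolding cell_mass_def
  proof (rule finite_measure_mono)
    show "{x. cell L M w (i + k) x = cell L M w (i + k) y} \<subseteq> cball y (\<beta> * (1 / 2 ^ i))"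
      using dist_le_of_same_cell[OF _ L] by (fastforce simp: \<beta>_def power_add mult_ac)
  qed (simp add: sets)
  also note y(2)
  also have "\<delta> * measure \<mu> (cball x (1 / 2 ^ i)) \<le> \<delta> * cell_mass \<mu> L M w i (cell L M w i x)"
    unfolding cell_mass_def using \<epsilon> sets cell_sets
    by (intro mult_left_mono finite_measure_mono) (auto intro: cell_eq_of_central[OF central L])
  finally have "light_descendant \<mu> L M w k \<delta> i (cell L M w i x) (cell L M w (i + k) y)"
    by (simp add: light_descendant_def ancestor_cell cell_y)
  thus ?thesis unfolding grid_hole_def by auto
qed

text \<open>
  The maximum with \<open>0\<close> makes the value \<open>0\<close> once \<open>\<epsilon>\<close> exceeds the relative volume \<open>2 powr (- d * k)\<close>,
  where the bound \<open>\<epsilon>\<close> on its relative mass does not distinguish a hole from other cells.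
\<close>
definition dim_drop :: "nat \<Rightarrow> nat \<Rightarrow> real \<Rightarrow> real" where
  "dim_drop d k \<epsilon> = log 2 (1 + (1 - 1 / 2 ^ d) * (max 0 (sqrt ((1 / 2 ^ d) ^ k) - sqrt \<epsilon>))\<^sup>2)"

text \<open>
  Only finitely many shifts are used. Hence almost every \<open>x\<close> satisfies the mass bound for all of them,
  from some level on, and at each level \<open>n\<close> the most favourable shift may be chosen.
\<close>
lemma packing_dim_le_of_larger_eps:
  fixes \<mu> :: "(real ^ 'n::finite) measure"
  assumes P: "prob_space \<mu>" and sets: "sets \<mu> = sets borel"
    and por: "mean_porous \<mu> \<alpha> \<eta> \<epsilon>" and \<epsilon>: "0 \<le> \<epsilon>" "\<epsilon> < \<delta>"
    and M: "odd M" and c: "real c \<le> real M * (1 - 2 / L)" and L: "0 < L"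
    and k: "0 < k" "L * sqrt (real CARD('n)) / 2 ^ k < \<alpha>"
  shows "packing_dim \<mu> \<le> ereal (real CARD('n) - \<eta> * ((real c / real M) ^ CARD('n) * dim_drop CARD('n) k \<delta>))"
proof -
  interpret prob_space \<mu> by fact
  define q :: real where "q = (1 / 2 ^ CARD('n)) ^ k"
  \<comment> \<open>For \<open>\<delta> \<ge> q\<close> the minimum turns the gain into \<open>1\<close>, and the trivial bound by the ambient dimension
    is obtained without a separate argument.\<close>
  define \<delta>' where "\<delta>' = min \<delta> q"
  have q: "0 < q" by (simp add: q_def)
  have \<delta>': "0 < \<delta>'" "\<delta>' \<le> (1 / 2 ^ CARD('n)) ^ k" using \<epsilon> q by (auto simp: \<delta>'_def q_def)
  define G where "G = 1 + (1 - 1 / 2 ^ CARD('n)) * (sqrt q - sqrt \<delta>')\<^sup>2"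
  define \<kappa> where "\<kappa> = sqrt (\<delta>' / q)"
  define p where "p = (real c / real M) ^ CARD('n)"
  define hole where "hole w = grid_hole \<mu> L M w k \<delta>'" for w
  have tree: "holed_tree parent (2 ^ CARD('n)) k (cell_mass \<mu> L M w) \<delta>' (hole w)" for w
    unfolding hole_def by (rule holed_tree_grid[OF P sets k(1) \<delta>'])
  have G: "1 \<le> G" by (simp add: G_def)
  have G_drop: "log 2 G = dim_drop CARD('n) k \<delta>"
    unfolding G_def dim_drop_def \<delta>'_def q_def[symmetric]
    by (cases "\<delta> \<le> q") (auto simp: min_def max_def)
  have \<kappa>: "0 < \<kappa>" using \<delta>' q by (simp add: \<kappa>_def)
  have p: "0 \<le> p" by (simp add: p_def)
  have "AE x in \<mu>. \<forall>w\<in>shifts M. \<forall>\<^sub>F n in sequentially.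
     G ^ card {i\<in>{0..<n}. hole w i (cell L M w i x) \<noteq> None} * (\<kappa> / 2 ^ (n * CARD('n)))
       \<le> (real n + 1) ^ 4 * cell_mass \<mu> L M w n (cell L M w n x)"
  proof (rule AE_finite_allI[OF finite_shifts])
    fix w :: "'n \<Rightarrow> nat"
    interpret T: holed_tree parent "2 ^ CARD('n)" k "cell_mass \<mu> L M w" \<delta>' "hole w" by (rule tree)
    have r: "T.child_vol = 1 / 2 ^ CARD('n)" by (simp add: T.child_vol_def)
    have gain: "T.gain = G" "T.\<kappa> = \<kappa>"
      by (simp_all add: T.gain_def T.slack_def T.hole_vol_def T.\<kappa>_def G_def \<kappa>_def r q_def)
    have rn: "T.child_vol ^ n * T.\<kappa> = \<kappa> / 2 ^ (n * CARD('n))" for n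
      by (simp add: r gain power_divide power_mult[symmetric] mult.commute)
    have cnt: "T.hole_count n (cell L M w n x) = card {i\<in>{0..<n}. hole w i (cell L M w i x) \<noteq> None}" for n x
      by (rule T.hole_count_eq_card) (rule parent_cell)
    have space: "space \<mu> = UNIV" using sets_eq_imp_space_eq[OF sets] by simp
    have "AE x in \<mu>. \<forall>\<^sub>F n in sequentially. T.gain ^ T.hole_count n (cell L M w n x) * (T.child_vol ^ n * T.\<kappa>)
        \<le> (real n + 1) ^ 4 * cell_mass \<mu> L M w n (cell L M w n x)"
      by (rule T.AE_cell_mass_ge[OF P]) (auto simp: space sets cell_sets parent_cell cell_mass_def)
    thus "AE x in \<mu>. \<forall>\<^sub>F n in sequentially.
      G ^ card {i\<in>{0..<n}. hole w i (cell L M w i x) \<noteq> None} * (\<kappa> / 2 ^ (n * CARD('n)))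
       \<le> (real n + 1) ^ 4 * cell_mass \<mu> L M w n (cell L M w n x)"
      unfolding rn gain(1) cnt .
  qed
  moreover have "AE x in \<mu>. ereal \<eta> \<le> liminf (\<lambda>n. ereal (1 / real n *
     real (card {i \<in> {0..<n}. por \<mu> x (2 powr (- real i)) \<epsilon> \<ge> ereal \<alpha>})))"
    using por by (simp add: mean_porous_def)
  ultimately have "AE x in \<mu>. upper_local_dim \<mu> x \<le> ereal (real CARD('n) - \<eta> * (p * ln G) / ln 2)"
  proof eventually_elim
    case (elim x)
    let ?S = "\<lambda>n. {i \<in> {0..<n}. por \<mu> x (2 powr (- real i)) \<epsilon> \<ge> ereal \<alpha>}"
    have "\<forall>\<^sub>F n in sequentially. \<forall>w\<in>shifts M.
     G ^ card {i\<in>{0..<n}. hole w i (cell L M w i x) \<noteq> None} * (\<kappa> / 2 ^ (n * CARD('n)))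
       \<le> (real n + 1) ^ 4 * cell_mass \<mu> L M w n (cell L M w n x)"
      using elim(1) by (intro eventually_ball_finite finite_shifts)
    hence mass: "\<forall>\<^sub>F n in sequentially. exp (p * ln G * real (card (?S n))) * \<kappa> / 2 ^ (n * CARD('n))
        \<le> (real n + 1) ^ 4 * measure \<mu> (cball x (L * sqrt (real CARD('n)) / 2 ^ n))"
    proof eventually_elim
      case (elim n)
      obtain w :: "'n \<Rightarrow> nat" where w: "w \<in> shifts M"
          "p * real (card (?S n)) \<le> real (card {i\<in>?S n. central L M w i x})"
        using exists_good_shift[OF M c L, of "?S n" x] by (auto simp: p_def)
      let ?N = "card {i\<in>{0..<n}. hole w i (cell L M w i x) \<noteq> None}"
      have "p * ln G * real (card (?S n)) \<le> real ?N * ln G"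
      proof (cases "\<delta> \<le> q")
        case True
        hence "\<delta>' = \<delta>" by (simp add: \<delta>'_def)
        hence "{i\<in>?S n. central L M w i x} \<subseteq> {i\<in>{0..<n}. hole w i (cell L M w i x) \<noteq> None}"
          using porous_central_imp_grid_hole[OF P sets _ \<epsilon>(2) _ L k(2)] \<epsilon> by (auto simp: hole_def)
        hence "card {i\<in>?S n. central L M w i x} \<le> ?N" by (intro card_mono) auto
        hence "p * real (card (?S n)) \<le> real ?N" using w(2) by linarith
        hence "(p * real (card (?S n))) * ln G \<le> real ?N * ln G" using G by (intro mult_right_mono) auto
        thus ?thesis by (simp add: mult_ac)
      next
        case False
        hence "G = 1" by (simp add: G_def \<delta>'_def)
        thus ?thesis by simp
      qed
      hence "exp (p * ln G * real (card (?S n))) \<le> exp (real ?N * ln G)" by simp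
      also have "\<dots> = G ^ ?N" using G by (simp add: exp_of_nat_mult)
      finally have "exp (p * ln G * real (card (?S n))) * (\<kappa> / 2 ^ (n * CARD('n)))
          \<le> G ^ ?N * (\<kappa> / 2 ^ (n * CARD('n)))" using \<kappa> by (intro mult_right_mono) auto
      also have "\<dots> \<le> (real n + 1) ^ 4 * cell_mass \<mu> L M w n (cell L M w n x)" using elim w by blast
      also have "\<dots> \<le> (real n + 1) ^ 4 * measure \<mu> (cball x (L * sqrt (real CARD('n)) / 2 ^ n))"
        unfolding cell_mass_def using dist_le_of_same_cell[OF _ L]
        by (intro mult_left_mono finite_measure_mono) (auto simp: sets)
      finally show ?case by simp
    qed
    show ?case
      by (rule upper_local_dim_le[OF P sets _ \<kappa> _ mass elim(2)]) (use L p G in auto)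
  qed
  hence "packing_dim \<mu> \<le> ereal (real CARD('n) - \<eta> * (p * ln G) / ln 2)"
    unfolding packing_dim_def by (intro esssup_I upper_local_dim_measurable P sets)
  thus ?thesis by (simp add: G_drop[symmetric] log_def p_def)
qed

lemma continuous_on_dim_drop: "continuous_on {0..} (dim_drop d k)"
  unfolding dim_drop_def log_def
proof (intro continuous_intros ballI)
  fix x :: real
  have "0 < 1 + (1 - 1 / 2 ^ d) * (max 0 (sqrt ((1 / 2 ^ d) ^ k) - sqrt x))\<^sup>2"
    by (intro add_pos_nonneg mult_nonneg_nonneg) auto
  thus "1 + (1 - 1 / 2 ^ d) * (max 0 (sqrt ((1 / 2 ^ d) ^ k) - sqrt x))\<^sup>2 \<noteq> 0" by simp
qed auto

lemma packing_dim_le: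
  fixes \<mu> :: "(real ^ 'n::finite) measure"
  assumes P: "prob_space \<mu>" and sets: "sets \<mu> = sets borel"
    and por: "mean_porous \<mu> \<alpha> \<eta> \<epsilon>" and \<epsilon>: "0 \<le> \<epsilon>"
    and M: "odd M" and c: "real c \<le> real M * (1 - 2 / L)" and L: "0 < L"
    and k: "0 < k" "L * sqrt (real CARD('n)) / 2 ^ k < \<alpha>"
  shows "packing_dim \<mu> \<le> ereal (real CARD('n) - \<eta> * ((real c / real M) ^ CARD('n) * dim_drop CARD('n) k \<epsilon>))"
proof -
  define e where "e n = \<epsilon> + 1 / real (Suc n)" for n
  have "e \<longlonglongrightarrow> \<epsilon> + 0"
    unfolding e_def by (intro tendsto_intros LIMSEQ_inverse_real_of_nat[unfolded inverse_eq_divide])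
  hence e: "e \<longlonglongrightarrow> \<epsilon>" by simp
  have e_gt: "\<epsilon> < e n" for n by (simp add: e_def)
  have "(\<lambda>n. dim_drop CARD('n) k (e n)) \<longlonglongrightarrow> dim_drop CARD('n) k \<epsilon>"
    using \<epsilon> order_trans[OF \<epsilon> less_imp_le[OF e_gt]]
    by (intro continuous_on_tendsto_compose[OF continuous_on_dim_drop e]) auto
  hence "(\<lambda>n. ereal (real CARD('n) - \<eta> * ((real c / real M) ^ CARD('n) * dim_drop CARD('n) k (e n))))
     \<longlonglongrightarrow> ereal (real CARD('n) - \<eta> * ((real c / real M) ^ CARD('n) * dim_drop CARD('n) k \<epsilon>))"
    by (intro tendsto_intros)
  thus ?thesis
    by (rule LIMSEQ_le_const)
       (intro exI[of _ 0] allI impI packing_dim_le_of_larger_eps[OF P sets por \<epsilon> e_gt M c L k])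
qed

section \<open>Choice of the parameters\<close>

lemma sqrt_power_self:
  assumes "0 < d"
  shows "real d powr (real d / 2) = sqrt (real d) ^ d"
proof -
  have "sqrt (real d) ^ d = (real d powr (1 / 2)) powr real d"
    using assms powr_realpow[of "sqrt (real d)" d] by (simp add: powr_half_sqrt)
  also have "\<dots> = real d powr (1 / 2 * real d)" by (rule powr_powr)
  finally show ?thesis by simp
qed

lemma threshold_eq:
  assumes "0 < d"
  shows "2 powr (- 2 * real d) * real d powr (- real d / 2) * \<alpha> ^ d = (\<alpha> / (4 * sqrt (real d))) ^ d"
proof -
  have "2 powr (- 2 * real d) = 1 / 4 ^ d"
    using powr_powr[of 2 2 "real d"] by (simp add: powr_minus powr_realpow divide_inverse)
  moreover have "real d powr (- real d / 2) = 1 / sqrt (real d) ^ d"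
    using powr_minus[of "real d" "real d / 2"]
    by (simp only: minus_divide_left sqrt_power_self[OF assms] inverse_eq_divide)
  ultimately show ?thesis by (simp only:) (simp add: power_divide power_mult_distrib)
qed

lemma c_const_eq:
  assumes "0 < d"
  shows "c_const d * \<alpha> ^ d = 2 / 5 * (\<alpha> / (4 * sqrt (real d))) ^ d / (4 ^ d * ln 2)"
proof -
  have "2 ^ (4 * d) = (4 ^ d * 4 ^ d :: real)"
    by (simp add: power_mult power_mult_distrib[symmetric])
  thus ?thesis
    unfolding c_const_def sqrt_power_self[OF assms]
    by (simp only:) (simp add: power_divide power_mult_distrib)
qed

lemma dim_drop_pos:
  assumes "0 < d" "\<epsilon> < (1 / 2 ^ d) ^ k"
  shows "0 < dim_drop d k \<epsilon>"
proof -
  have "sqrt \<epsilon> < sqrt ((1 / 2 ^ d) ^ k)" using assms by simp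
  hence "0 < (max 0 (sqrt ((1 / 2 ^ d) ^ k) - sqrt \<epsilon>))\<^sup>2" by simp
  moreover have "0 < 1 - 1 / (2::real) ^ d" using assms by simp
  ultimately have "0 < (1 - 1 / 2 ^ d) * (max 0 (sqrt ((1 / 2 ^ d) ^ k) - sqrt \<epsilon>))\<^sup>2"
    by (rule mult_pos_pos[rotated])
  thus ?thesis by (simp add: dim_drop_def)
qed

text \<open>
  For \<open>\<epsilon> = 0\<close> the gain is \<open>1 + x\<close> with \<open>q / 2 \<le> x \<le> q \<le> 1 / 8\<close>, and \<open>ln (1 + x) \<ge> x - x\<^sup>2 \<ge> 7 / 8 * x\<close>.
\<close>
lemma dim_drop_0_ge:
  assumes "0 < d" "(1 / 2 ^ d) ^ k \<le> (1 / 8 :: real)"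
  shows "7 / 16 * (1 / 2 ^ d) ^ k / ln 2 \<le> dim_drop d k 0"
proof -
  define q :: real where "q = (1 / 2 ^ d) ^ k"
  define x where "x = (1 - 1 / 2 ^ d) * q"
  have q: "0 < q" "q \<le> 1 / 8" using assms by (auto simp: q_def)
  have "2 ^ 1 \<le> (2::real) ^ d" using assms by (intro power_increasing) auto
  hence "1 / 2 \<le> 1 - 1 / (2::real) ^ d" by (simp add: field_simps)
  hence "1 / 2 * q \<le> x" unfolding x_def using q by (intro mult_right_mono) auto
  moreover have "x \<le> 1 * q" unfolding x_def using q by (intro mult_right_mono) auto
  ultimately have x: "1 / 2 * q \<le> x" "0 \<le> x" "x \<le> 1 / 8" using q by auto
  have "x * x \<le> 1 / 8 * x" using x by (intro mult_right_mono) auto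
  hence "7 / 16 * q \<le> x - x\<^sup>2" using x by (simp add: power2_eq_square)
  also have "\<dots> \<le> ln (1 + x)" using x by (intro ln_one_plus_pos_lower_bound) auto
  finally have "7 / 16 * q / ln 2 \<le> ln (1 + x) / ln 2" by (intro divide_right_mono) auto
  moreover have "dim_drop d k 0 = ln (1 + x) / ln 2"
    using q by (simp add: dim_drop_def q_def[symmetric] x_def log_def)
  ultimately show ?thesis by (simp add: q_def)
qed

theorem theorem1p7:
  fixes \<alpha> :: real and d :: nat
  assumes d: "d = CARD('n::finite)"
    and \<alpha>: "0 < \<alpha>" "\<alpha> \<le> 1 / 2"
  shows "\<exists>t :: real \<Rightarrow> real.
    continuous_on {0..<1} t \<and>
    (\<forall>\<epsilon>\<in>{0..<1}. \<epsilon> < 2 powr (- 2 * real d) * real d powr (- real d / 2) * \<alpha> ^ d \<longrightarrow> t \<epsilon> > 0) \<and>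
    (\<exists>\<epsilon>0>0. \<forall>\<epsilon>\<in>{0..<1}. \<epsilon> < \<epsilon>0 \<longrightarrow> t \<epsilon> > c_const d * \<alpha> ^ d) \<and>
    t 0 > c_const d * \<alpha> ^ d \<and>
    (\<forall>(\<mu> :: (real ^ 'n) measure) \<eta> \<epsilon>.
       prob_space \<mu> \<longrightarrow> sets \<mu> = sets borel \<longrightarrow>
       0 < \<eta> \<longrightarrow> \<eta> \<le> 1 \<longrightarrow> 0 \<le> \<epsilon> \<longrightarrow> \<epsilon> < 1 \<longrightarrow>
       mean_porous \<mu> \<alpha> \<eta> \<epsilon> \<longrightarrow>
       packing_dim \<mu> \<le> ereal (real d - \<eta> * t \<epsilon>))"
proof -
  have d0: "0 < d" by (simp add: d)
  define s where "s = sqrt (real d)"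
  have s: "1 \<le> s" using d0 by (simp add: s_def)
  define Y where "Y = 4 * s / \<alpha>"
  have Y: "8 \<le> Y" using s \<alpha> by (simp add: Y_def field_simps)
  define \<theta> where "\<theta> = (1 / Y) ^ d"
  have \<theta>: "2 powr (- 2 * real d) * real d powr (- real d / 2) * \<alpha> ^ d = \<theta>"
    "c_const d * \<alpha> ^ d = 2 / 5 * \<theta> / (4 ^ d * ln 2)"
    unfolding threshold_eq[OF d0] c_const_eq[OF d0] by (simp_all add: \<theta>_def Y_def s_def)
  define k where "k = nat \<lfloor>log 2 Y\<rfloor>"
  have "3 \<le> log 2 Y" using Y by (simp add: le_log_iff)
  hence k: "0 < k" "real k \<le> log 2 Y" "log 2 Y < real (Suc k)" unfolding k_def by linarith+
  have k_le: "2 ^ k \<le> Y" using k(2) Y by (simp add: le_log_iff powr_realpow)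
  have k_gt: "Y < 2 * 2 ^ k" using k(3) Y powr_realpow[of 2 "Suc k"] by (simp add: log_less_iff del: of_nat_Suc)
  \<comment> \<open>With the largest possible \<open>2 ^ k \<le> 4 * s / \<alpha>\<close>, the relative volume of a hole is at least \<open>\<theta>\<close>. As
    \<open>L0 > 2\<close>, there is room for a side length \<open>L > 2\<close>. The central part of a cell is then nonempty, and
    one of sufficiently many shifts hits it.\<close>
  define L0 where "L0 = 2 ^ k * \<alpha> / s"
  have L0: "2 < L0" using k_gt \<alpha> s by (simp add: L0_def Y_def field_simps)
  define L where "L = (2 + L0) / 2"
  have L: "2 < L" "L < L0" using L0 by (auto simp: L_def)
  have kL: "L * s / 2 ^ k < \<alpha>" using L(2) s by (simp add: L0_def field_simps)
  obtain m :: nat where m: "1 / (1 - 2 / L) < real m" using reals_Archimedean2 by blast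
  define M where "M = 2 * m + 1"
  have "1 / (1 - 2 / L) \<le> real M" using m by (simp add: M_def)
  moreover have "0 < 1 - 2 / L" using L by simp
  ultimately have cM: "real 1 \<le> real M * (1 - 2 / L)" by (simp add: pos_divide_le_eq)
  have M: "odd M" "0 < M" by (auto simp: M_def)
  \<comment> \<open>One level more permits the side length \<open>4\<close>: the central part is the middle half in each coordinate,
    which almost half of the \<open>20 * d + 1\<close> shifts hit. In all \<open>d\<close> coordinates this is the share
    \<open>2 powr (- d)\<close> up to a factor \<open>19 / 20\<close>. Together with the factor \<open>7 / 16\<close> from \<open>dim_drop_0_ge\<close>,
    the estimate succeeds because \<open>19 / 20 * 7 / 16 > 2 / 5\<close>.\<close>
  have kL': "4 * s / 2 ^ Suc k < \<alpha>" using k_gt \<alpha> by (simp add: Y_def field_simps)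
  define M' where "M' = 20 * d + 1"
  have M': "odd M'" by (simp add: M'_def)
  have cM': "real (10 * d) \<le> real M' * (1 - 2 / 4)" by (simp add: M'_def)
  define t1 where "t1 \<epsilon> = (real 1 / real M) ^ d * dim_drop d k \<epsilon>" for \<epsilon>
  define t2 where "t2 \<epsilon> = (real (10 * d) / real M') ^ d * dim_drop d (Suc k) \<epsilon>" for \<epsilon>
  define t where "t \<epsilon> = max (t1 \<epsilon>) (t2 \<epsilon>)" for \<epsilon>
  have cont: "continuous_on {0..<1} t"
    unfolding t_def[abs_def] t1_def t2_def
    by (intro continuous_intros continuous_on_subset[OF continuous_on_dim_drop]) auto
  have pos: "0 < t \<epsilon>" if "\<epsilon> < \<theta>" for \<epsilon>
  proof -
    have "1 / Y \<le> 1 / 2 ^ k" using k_le Y by (intro divide_left_mono) auto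
    hence "\<theta> \<le> (1 / 2 ^ k) ^ d" unfolding \<theta>_def using Y by (intro power_mono) auto
    also have "\<dots> = (1 / 2 ^ d) ^ k" by (simp add: power_divide power_mult[symmetric] mult.commute)
    finally have "0 < dim_drop d k \<epsilon>" using that by (intro dim_drop_pos d0) auto
    thus ?thesis using M by (auto simp: t_def t1_def less_max_iff_disj)
  qed
  have large: "c_const d * \<alpha> ^ d < t 0"
  proof -
    define q :: real where "q = (1 / 2 ^ d) ^ Suc k"
    have q: "q = (1 / 2 ^ Suc k) ^ d" by (simp add: q_def power_divide power_mult[symmetric] mult.commute del: power_Suc)
    have "1 / (2 * Y) \<le> 1 / 2 ^ Suc k" using k_le Y by (intro divide_left_mono) auto
    hence "(1 / (2 * Y)) ^ d \<le> q" unfolding q using Y by (intro power_mono) auto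
    hence q_ge: "\<theta> / 2 ^ d \<le> q" by (simp add: \<theta>_def power_divide power_mult_distrib mult.commute)
    have "(8::real) \<le> 2 ^ Suc k" using k_gt Y by simp
    hence "1 / 2 ^ Suc k \<le> (1 / 8 :: real)" by (intro divide_left_mono) auto
    hence "q \<le> (1 / 8) ^ d" unfolding q by (intro power_mono) auto
    also have "\<dots> \<le> (1 / 8) ^ 1" using d0 by (intro power_decreasing) auto
    finally have q8: "q \<le> 1 / 8" by simp
    have \<theta>0: "0 < \<theta>" using Y by (simp add: \<theta>_def)
    have p: "19 / 20 / 2 ^ d \<le> (real (10 * d) / real M') ^ d"
    proof -
      define z where "z = 1 / real M'"
      have "real d * z \<le> 1 / 20" by (simp add: z_def M'_def field_simps)
      moreover have "1 + real d * (- z) \<le> (1 + (- z)) ^ d"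
        by (rule Bernoulli_inequality) (simp add: z_def M'_def)
      ultimately have z: "19 / 20 \<le> (1 - z) ^ d" by simp
      have "real (10 * d) / real M' = (1 - z) / 2" by (simp add: z_def M'_def field_simps)
      hence eq: "(real (10 * d) / real M') ^ d = (1 - z) ^ d / 2 ^ d" by (simp only: power_divide)
      show ?thesis unfolding eq using z by (rule divide_right_mono) simp
    qed
    have "c_const d * \<alpha> ^ d = 2 / 5 * (\<theta> / (4 ^ d * ln 2))" by (simp add: \<theta>(2))
    also have "\<dots> < (19 / 20 * (7 / 16)) * (\<theta> / (4 ^ d * ln 2))"
      using \<theta>0 by (intro mult_strict_right_mono) auto
    also have "\<dots> = (19 / 20 / 2 ^ d) * (7 / 16 * (\<theta> / 2 ^ d) / ln 2)"
      by (simp add: power_mult_distrib[symmetric])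
    also have "\<dots> \<le> (real (10 * d) / real M') ^ d * (7 / 16 * q / ln 2)"
      using p q_ge \<theta>0 by (intro mult_mono divide_right_mono) auto
    also have "\<dots> \<le> t2 0"
      unfolding t2_def using dim_drop_0_ge[OF d0, of "Suc k"] q8 by (intro mult_left_mono) (auto simp: q_def)
    also have "\<dots> \<le> t 0" by (simp add: t_def)
    finally show ?thesis .
  qed
  have near: "\<exists>\<epsilon>0>0. \<forall>\<epsilon>\<in>{0..<1}. \<epsilon> < \<epsilon>0 \<longrightarrow> t \<epsilon> > c_const d * \<alpha> ^ d"
  proof -
    have "0 < t 0 - c_const d * \<alpha> ^ d" "(0::real) \<in> {0..<1}" using large by auto
    then obtain \<epsilon>0 where e: "\<epsilon>0 > 0"
      "\<forall>\<epsilon>\<in>{0..<1}. dist \<epsilon> 0 < \<epsilon>0 \<longrightarrow> dist (t \<epsilon>) (t 0) < t 0 - c_const d * \<alpha> ^ d"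
      using cont unfolding continuous_on_iff by blast
    show ?thesis
    proof (intro exI[of _ \<epsilon>0] conjI ballI impI e(1))
      fix \<epsilon> assume "\<epsilon> \<in> {0..<1}" "\<epsilon> < \<epsilon>0"
      thus "t \<epsilon> > c_const d * \<alpha> ^ d" using bspec[OF e(2), of \<epsilon>] by (auto simp: dist_real_def)
    qed
  qed
  have bound: "packing_dim \<mu> \<le> ereal (real d - \<eta> * t \<epsilon>)"
    if "prob_space \<mu>" "sets \<mu> = sets borel" "0 \<le> \<epsilon>" "mean_porous \<mu> \<alpha> \<eta> \<epsilon>"
    for \<mu> :: "(real ^ 'n) measure" and \<eta> \<epsilon>
  proof -
    have "packing_dim \<mu> \<le> ereal (real d - \<eta> * t1 \<epsilon>)"
      using packing_dim_le[OF that(1,2,4,3) M(1) cM _ k(1)] L kL by (simp add: t1_def d s_def)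
    moreover have "packing_dim \<mu> \<le> ereal (real d - \<eta> * t2 \<epsilon>)"
      using packing_dim_le[OF that(1,2,4,3) M' cM' _ zero_less_Suc[of k]] kL'
      unfolding t2_def d s_def by simp
    ultimately show ?thesis by (simp add: t_def max_def)
  qed
  show ?thesis
    unfolding \<theta>(1) using cont pos near large bound by (intro exI[of _ t]) blast
qed

end
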